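(* Let $\mathbb K$ be a commutative unital ring, $(U,V)$ and $(U',V')$ linear sets over $\mathbb K$, and $f:U\to U'$ an arbitrary map of sets. Then there is a unique family of morphisms of $n$-fold groupoids $\mathsf{Gfi}^{\mathsf n}U\to\mathsf{Gfi}^{\mathsf n}U'$, $n\ge0$, compatible with each other, whose $0$-th member is $f$; and there is a unique family of morphisms of $2n$-fold categories $\mathsf{Gfi}^{\overline{\mathsf n}}U\to\mathsf{Gfi}^{\overline{\mathsf n}}U'$, $n\ge0$, compatible with each other, whose $0$-th member is $f$.
   Context: A linear set is a pair $(U,V)$, $V$ a $\mathbb K$-module, $U\subset V$. **$m$-fold categories.** A small category has source $\pi_0$, target $\pi_1$, unit section, product $g'*g$ defined iff $\pi_1(g)=\pi_0(g')$. A small $m$-fold category indexed by a finite set $N$ ($|N|=m$) is a family of sets $(C_\alpha)_{\alpha\subset N}$ with a small category (morphisms $C_\alpha$, objects $C_\beta$) for each edge $(\beta,\alpha=\beta\cup\{i\})$, $i\notin\beta$, such that on each face the four edge categories form a double category (structure maps in one direction are functors for the other). It is an $m$-fold groupoid if all edge categories are groupoids. Morphisms are families of maps of vertex sets that are functors on each edge category. **Finite part, first order.** For a subset $X$ of a $\mathbb K$-module $E$: $\mathsf{Gfi}^{\{k\}}X$ is the groupoid with objects $X\times\mathbb K^\times$, morphisms $\{(x,v,t)\in E^2\times\mathbb K^\times:x\in X,\ x+tv\in X\}$, $\pi_0(x,v,t)=(x,t)$, $\pi_1(x,v,t)=(x+tv,t)$, unit $(x,0,t)$, $(x',v',t)*(x,v,t)=(x,v+v',t)$.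 $\mathsf{Gfi}^{\overline{\{k\}}}X$ is the double category indexed by $\{k,k'\}$ with vertex sets $C_\emptyset=X\times\mathbb K^\times$, $C_{\{k\}}=\{(x,v,t)\in E^2\times\mathbb K^\times:x\in X,\ x+tv\in X\}$, $C_{\{k'\}}=X\times(\mathbb K^\times)^2$, $C_{\{k,k'\}}=\{(x,v,s,t)\in E^2\times(\mathbb K^\times)^2:x\in X,\ x+stv\in X\}$; in direction $k$, on the edge $(\emptyset,\{k\})$: $\pi_0(x,v,t)=(x,t)$, $\pi_1(x,v,t)=(x+tv,t)$, unit $(x,0,t)$, $(x',v',t)*(x,v,t)=(x,v+v',t)$, and on the edge $(\{k'\},\{k,k'\})$: $\pi_0(x,v,s,t)=(x,s,t)$, $\pi_1(x,v,s,t)=(x+stv,s,t)$, unit $(x,0,s,t)$, $(x',v',s,t)*(x,v,s,t)=(x,v+v',s,t)$; in direction $k'$: source $\partial_0(x,s,t)=(x,st)$, target $\partial_1(x,s,t)=(x,t)$, unit $(x,1,t)$, $(x,s',t')\bullet(x,s,t)=(x,ss',t')$, and $\partial_0(x,v,s,t)=(x,v,st)$, $\partial_1(x,v,s,t)=(x,sv,t)$, unit $(x,v,1,t)$, $(x,v',s',t')\bullet(x,v,s,t)=(x,v,ss',t')$. For a map $h:X\to X'$ of such subsets, $h^{\{1\}}(x,v,t)=\bigl(h(x),\frac{h(x+tv)-h(x)}{t},t\bigr)$ and $h^{\overline{\{1\}}}(x,v,s,t)=\bigl(h(x),\frac{h(x+stv)-h(x)}{st},s,t\bigr)$ for invertible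 $s,t$. **Recursion.** $\mathsf{Gfi}^{\mathsf 0}U=\mathsf{Gfi}^{\overline{\mathsf 0}}U=U$. $\mathsf{Gfi}^{\mathsf n}U$ is indexed by $\{1,\dots,n\}$: if $X_\alpha$ are the vertex sets of $\mathsf{Gfi}^{\mathsf{n-1}}U$, then the vertex sets at $\alpha$, $\alpha\cup\{n\}$ are the object and morphism sets of $\mathsf{Gfi}^{\{n\}}X_\alpha$, with this groupoid as structure in direction $n$, and in old directions each structure map $h$ is replaced by $h\times\mathrm{id}_{\mathbb K^\times}$, resp. $h^{\{1\}}$ (products restricted to pairs composable for the derived projections). Similarly $\mathsf{Gfi}^{\overline{\mathsf n}}U$ is indexed by $\{1,1',\dots,n,n'\}$: if $X_\alpha$ are the vertex sets of $\mathsf{Gfi}^{\overline{\mathsf{n-1}}}U$, at $\alpha,\alpha\cup\{n\},\alpha\cup\{n'\},\alpha\cup\{n,n'\}$ one takes the four vertex sets of $\mathsf{Gfi}^{\overline{\{n\}}}X_\alpha$, with its structure in directions $n,n'$, and in old directions structure maps $h$ are replaced by $h\times\mathrm{id}$, $h^{\{1\}}$, $h\times\mathrm{id}$, $h^{\overline{\{1\}}}$. **Compatibility.** A family of morphisms $\mathbf f^{\mathsf n}$ (resp. $\mathbf f^{\overline{\mathsf n}}$), $n\ge0$, is compatible if for every $n\ge1$ the vertex map of the $n$-th morphism at each vertex $\alpha$ not containing $n$ (resp. containing neither $n$ nor $n'$) is the corresponding vertex map of the $(n-1)$-st morphism times $\mathrm{id}_{\mathbb K^\times}$. *)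

theory Defs
  imports "HOL-Algebra.Module" "HOL-Library.FuncSet"
begin

section \<open>Small categories, double categories, m-fold categories\<close>

text \<open>In \<open>prd C g' g\<close>, as in \<open>g' * g\<close>, the right factor is applied first. Only the values on
  composable pairs matter.\<close>

record ('o, 'm) small_cat =
  Obj :: "'o set"
  Mor :: "'m set"
  src :: "'m \<Rightarrow> 'o"
  tgt :: "'m \<Rightarrow> 'o"
  unt :: "'o \<Rightarrow> 'm"
  prd :: "'m \<Rightarrow> 'm \<Rightarrow> 'm"

definition composable :: "('o, 'm) small_cat \<Rightarrow> ('m \<times> 'm) set" where
  "composable C = {(g', g). g' \<in> Mor C \<and> g \<in> Mor C \<and> tgt C g = src C g'}"

definition small_category :: "('o, 'm) small_cat \<Rightarrow> bool" where
  "small_category C \<longleftrightarrow>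
     src C \<in> Mor C \<rightarrow> Obj C \<and> tgt C \<in> Mor C \<rightarrow> Obj C \<and> unt C \<in> Obj C \<rightarrow> Mor C \<and>
     (\<forall>x\<in>Obj C. src C (unt C x) = x \<and> tgt C (unt C x) = x) \<and>
     (\<forall>(g', g)\<in>composable C. prd C g' g \<in> Mor C \<and>
        src C (prd C g' g) = src C g \<and> tgt C (prd C g' g) = tgt C g') \<and>
     (\<forall>g\<in>Mor C. prd C g (unt C (src C g)) = g \<and> prd C (unt C (tgt C g)) g = g) \<and>
     (\<forall>g'' g' g. (g'', g') \<in> composable C \<longrightarrow> (g', g) \<in> composable C \<longrightarrow>
        prd C g'' (prd C g' g) = prd C (prd C g'' g') g)"

definition small_groupoid :: "('o, 'm) small_cat \<Rightarrow> bool" where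
  "small_groupoid C \<longleftrightarrow> small_category C \<and>
     (\<forall>g\<in>Mor C. \<exists>g'\<in>Mor C. src C g' = tgt C g \<and> tgt C g' = src C g \<and>
        prd C g' g = unt C (src C g) \<and> prd C g g' = unt C (tgt C g))"

definition is_functor ::
  "('o, 'm) small_cat \<Rightarrow> ('p, 'n) small_cat \<Rightarrow> ('o \<Rightarrow> 'p) \<Rightarrow> ('m \<Rightarrow> 'n) \<Rightarrow> bool" where
  "is_functor C D Fo Fm \<longleftrightarrow>
     Fo \<in> Obj C \<rightarrow> Obj D \<and> Fm \<in> Mor C \<rightarrow> Mor D \<and>
     (\<forall>g\<in>Mor C. src D (Fm g) = Fo (src C g) \<and> tgt D (Fm g) = Fo (tgt C g)) \<and>
     (\<forall>x\<in>Obj C. Fm (unt C x) = unt D (Fo x)) \<and>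
     (\<forall>(g', g)\<in>composable C. Fm (prd C g' g) = prd D (Fm g') (Fm g))"

text \<open>A face with vertex sets \<open>C\<^sub>0\<close>, \<open>C\<^sub>i\<close>, \<open>C\<^sub>j\<close>, \<open>C\<^sub>i\<^sub>j\<close> is given by its four edge categories:
  in direction \<open>i\<close>, \<open>A\<close> on \<open>(C\<^sub>0, C\<^sub>i)\<close> and \<open>B\<close> on \<open>(C\<^sub>j, C\<^sub>i\<^sub>j)\<close>;
  in direction \<open>j\<close>, \<open>P\<close> on \<open>(C\<^sub>0, C\<^sub>j)\<close> and \<open>Q\<close> on \<open>(C\<^sub>i, C\<^sub>i\<^sub>j)\<close>.
  The following category, in direction \<open>j\<close>, is the domain of the product of direction \<open>i\<close>.\<close>

definition composable_cat ::
  "('a, 'b) small_cat \<Rightarrow> ('c, 'd) small_cat \<Rightarrow> ('b, 'd) small_cat \<Rightarrow> ('b \<times> 'b, 'd \<times> 'd) small_cat" where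
  "composable_cat A B Q =
     \<lparr>Obj = composable A, Mor = composable B,
      src = map_prod (src Q) (src Q), tgt = map_prod (tgt Q) (tgt Q),
      unt = map_prod (unt Q) (unt Q),
      prd = (\<lambda>(h', h) (g', g). (prd Q h' g', prd Q h g))\<rparr>"

definition structure_maps_functorial ::
  "('a, 'b) small_cat \<Rightarrow> ('c, 'd) small_cat \<Rightarrow> ('a, 'c) small_cat \<Rightarrow> ('b, 'd) small_cat \<Rightarrow> bool" where
  "structure_maps_functorial A B P Q \<longleftrightarrow>
     is_functor Q P (src A) (src B) \<and>
     is_functor Q P (tgt A) (tgt B) \<and>
     is_functor P Q (unt A) (unt B) \<and>
     is_functor (composable_cat A B Q) Q (\<lambda>(g', g). prd A g' g) (\<lambda>(g', g). prd B g' g)"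

definition double_category ::
  "('a, 'b) small_cat \<Rightarrow> ('c, 'd) small_cat \<Rightarrow> ('a, 'c) small_cat \<Rightarrow> ('b, 'd) small_cat \<Rightarrow> bool" where
  "double_category A B P Q \<longleftrightarrow>
     small_category A \<and> small_category B \<and> small_category P \<and> small_category Q \<and>
     Obj A = Obj P \<and> Mor A = Obj Q \<and> Obj B = Mor P \<and> Mor B = Mor Q \<and>
     structure_maps_functorial A B P Q \<and> structure_maps_functorial P Q A B"

text \<open>\<open>edge C \<beta> i\<close> is the category attached to the edge from \<open>\<beta>\<close> to \<open>insert i \<beta>\<close>.\<close>

record ('i, 'a) mfold =
  index :: "'i set"
  vertex :: "'i set \<Rightarrow> 'a set"
  edge :: "'i set \<Rightarrow> 'i \<Rightarrow> ('a, 'a) small_cat"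

definition mfold_category :: "('i, 'a) mfold \<Rightarrow> bool" where
  "mfold_category C \<longleftrightarrow> finite (index C) \<and>
     (\<forall>\<beta> i. \<beta> \<subseteq> index C \<longrightarrow> i \<in> index C - \<beta> \<longrightarrow>
        small_category (edge C \<beta> i) \<and>
        Obj (edge C \<beta> i) = vertex C \<beta> \<and> Mor (edge C \<beta> i) = vertex C (insert i \<beta>)) \<and>
     (\<forall>\<beta> i j. \<beta> \<subseteq> index C \<longrightarrow> i \<in> index C - \<beta> \<longrightarrow> j \<in> index C - \<beta> \<longrightarrow> i \<noteq> j \<longrightarrow>
        double_category (edge C \<beta> i) (edge C (insert j \<beta>) i)
                        (edge C \<beta> j) (edge C (insert i \<beta>) j))"

definition mfold_groupoid :: "('i, 'a) mfold \<Rightarrow> bool" where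
  "mfold_groupoid C \<longleftrightarrow> mfold_category C \<and>
     (\<forall>\<beta> i. \<beta> \<subseteq> index C \<longrightarrow> i \<in> index C - \<beta> \<longrightarrow> small_groupoid (edge C \<beta> i))"

text \<open>The vertex maps are taken as extensional functions on extensional index sets, so that equality
  of HOL functions is equality of morphisms.\<close>

definition mfold_category_morphism ::
  "('i, 'a) mfold \<Rightarrow> ('i, 'b) mfold \<Rightarrow> ('i set \<Rightarrow> 'a \<Rightarrow> 'b) \<Rightarrow> bool" where
  "mfold_category_morphism C D F \<longleftrightarrow>
     mfold_category C \<and> mfold_category D \<and> index C = index D \<and>
     F \<in> (\<Pi>\<^sub>E \<alpha>\<in>Pow (index C). vertex C \<alpha> \<rightarrow>\<^sub>E vertex D \<alpha>) \<and>
     (\<forall>\<beta> i. \<beta> \<subseteq> index C \<longrightarrow> i \<in> index C - \<beta> \<longrightarrow>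
        is_functor (edge C \<beta> i) (edge D \<beta> i) (F \<beta>) (F (insert i \<beta>)))"

definition mfold_groupoid_morphism ::
  "('i, 'a) mfold \<Rightarrow> ('i, 'b) mfold \<Rightarrow> ('i set \<Rightarrow> 'a \<Rightarrow> 'b) \<Rightarrow> bool" where
  "mfold_groupoid_morphism C D F \<longleftrightarrow>
     mfold_groupoid C \<and> mfold_groupoid D \<and> mfold_category_morphism C D F"


section \<open>Linear sets and the ambient modules\<close>

definition linear_set :: "'k ring \<Rightarrow> 'v set \<Rightarrow> ('k, 'v) module \<Rightarrow> bool" where
  "linear_set K U V \<longleftrightarrow> module K V \<and> U \<subseteq> carrier V"

text \<open>The vertex sets of the iterated constructions live in products of copies of \<open>V\<close> and \<open>K\<close>
  that depend on the vertex. All these products are realised inside one type of nested tuples;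
  \<open>(x \<^bold>, v \<^bold>, Scal t)\<close> is the triple \<open>(x, v, t)\<close>.\<close>

datatype ('v, 'k) tup =
    Vec (unVec: 'v)
  | Scal (unScal: 'k)
  | Tup (tfst: "('v, 'k) tup") (tsnd: "('v, 'k) tup")  (infixr "\<^bold>," 60)

text \<open>The components \<open>mult\<close> and \<open>one\<close> of a module record carry no meaning.\<close>

definition vec_module :: "('k, 'v) module \<Rightarrow> ('k, ('v, 'k) tup) module" where
  "vec_module V =
     \<lparr>carrier = Vec ` carrier V, mult = undefined, one = undefined, zero = Vec \<zero>\<^bsub>V\<^esub>,
      add = (\<lambda>p q. Vec (unVec p \<oplus>\<^bsub>V\<^esub> unVec q)),
      smult = (\<lambda>c p. Vec (c \<odot>\<^bsub>V\<^esub> unVec p))\<rparr>"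

definition scal_module :: "'k ring \<Rightarrow> ('k, ('v, 'k) tup) module" where
  "scal_module K =
     \<lparr>carrier = Scal ` carrier K, mult = undefined, one = undefined, zero = Scal \<zero>\<^bsub>K\<^esub>,
      add = (\<lambda>p q. Scal (unScal p \<oplus>\<^bsub>K\<^esub> unScal q)),
      smult = (\<lambda>c p. Scal (c \<otimes>\<^bsub>K\<^esub> unScal p))\<rparr>"

definition prod_module ::
  "('k, ('v, 'k) tup) module \<Rightarrow> ('k, ('v, 'k) tup) module \<Rightarrow> ('k, ('v, 'k) tup) module"
  (infixr "\<times>\<^sub>m" 70) where
  "M \<times>\<^sub>m N =
     \<lparr>carrier = {(x \<^bold>, y) | x y. x \<in> carrier M \<and> y \<in> carrier N},
      mult = undefined, one = undefined, zero = (\<zero>\<^bsub>M\<^esub> \<^bold>, \<zero>\<^bsub>N\<^esub>),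
      add = (\<lambda>p q. (tfst p \<oplus>\<^bsub>M\<^esub> tfst q) \<^bold>, (tsnd p \<oplus>\<^bsub>N\<^esub> tsnd q)),
      smult = (\<lambda>c p. (c \<odot>\<^bsub>M\<^esub> tfst p) \<^bold>, (c \<odot>\<^bsub>N\<^esub> tsnd p))\<rparr>"


section \<open>First order\<close>

text \<open>Below, \<open>E\<close> is the module containing \<open>X\<close>. Names ending in \<open>b\<close> belong to the
  double category (the overlined version) only.\<close>

definition pts :: "'k ring \<Rightarrow> ('k, ('v, 'k) tup) module \<Rightarrow> ('v, 'k) tup set \<Rightarrow> ('v, 'k) tup set" where
  "pts K E X = {(x \<^bold>, Scal t) | x t. x \<in> X \<and> t \<in> Units K}"

definition incs :: "'k ring \<Rightarrow> ('k, ('v, 'k) tup) module \<Rightarrow> ('v, 'k) tup set \<Rightarrow> ('v, 'k) tup set" where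
  "incs K E X = {(x \<^bold>, v \<^bold>, Scal t) | x v t.
     x \<in> X \<and> v \<in> carrier E \<and> t \<in> Units K \<and> x \<oplus>\<^bsub>E\<^esub> t \<odot>\<^bsub>E\<^esub> v \<in> X}"

definition ptsb :: "'k ring \<Rightarrow> ('k, ('v, 'k) tup) module \<Rightarrow> ('v, 'k) tup set \<Rightarrow> ('v, 'k) tup set" where
  "ptsb K E X = {(x \<^bold>, Scal s \<^bold>, Scal t) | x s t. x \<in> X \<and> s \<in> Units K \<and> t \<in> Units K}"

definition incsb :: "'k ring \<Rightarrow> ('k, ('v, 'k) tup) module \<Rightarrow> ('v, 'k) tup set \<Rightarrow> ('v, 'k) tup set" where
  "incsb K E X = {(x \<^bold>, v \<^bold>, Scal s \<^bold>, Scal t) | x v s t.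
     x \<in> X \<and> v \<in> carrier E \<and> s \<in> Units K \<and> t \<in> Units K \<and>
     x \<oplus>\<^bsub>E\<^esub> (s \<otimes>\<^bsub>K\<^esub> t) \<odot>\<^bsub>E\<^esub> v \<in> X}"

text \<open>The structure maps in direction \<open>k\<close>, on the edges starting at the empty set and at \<open>{k'}\<close>.\<close>

fun pi0 :: "('v, 'k) tup \<Rightarrow> ('v, 'k) tup" where
  "pi0 (x \<^bold>, v \<^bold>, Scal t) = (x \<^bold>, Scal t)"

fun pi1 :: "('k, ('v, 'k) tup) module \<Rightarrow> ('v, 'k) tup \<Rightarrow> ('v, 'k) tup" where
  "pi1 E (x \<^bold>, v \<^bold>, Scal t) = (x \<oplus>\<^bsub>E\<^esub> t \<odot>\<^bsub>E\<^esub> v \<^bold>, Scal t)"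

fun pi_unt :: "('k, ('v, 'k) tup) module \<Rightarrow> ('v, 'k) tup \<Rightarrow> ('v, 'k) tup" where
  "pi_unt E (x \<^bold>, Scal t) = (x \<^bold>, \<zero>\<^bsub>E\<^esub> \<^bold>, Scal t)"

fun pi_prd :: "('k, ('v, 'k) tup) module \<Rightarrow> ('v, 'k) tup \<Rightarrow> ('v, 'k) tup \<Rightarrow> ('v, 'k) tup" where
  "pi_prd E (x' \<^bold>, v' \<^bold>, Scal t') (x \<^bold>, v \<^bold>, Scal t) = (x \<^bold>, v \<oplus>\<^bsub>E\<^esub> v' \<^bold>, Scal t)"

definition Gfi1 ::
  "'k ring \<Rightarrow> ('k, ('v, 'k) tup) module \<Rightarrow> ('v, 'k) tup set
    \<Rightarrow> (('v, 'k) tup, ('v, 'k) tup) small_cat" where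
  "Gfi1 K E X = \<lparr>Obj = pts K E X, Mor = incs K E X,
     src = pi0, tgt = pi1 E, unt = pi_unt E, prd = pi_prd E\<rparr>"

fun pi0b :: "('v, 'k) tup \<Rightarrow> ('v, 'k) tup" where
  "pi0b (x \<^bold>, v \<^bold>, Scal s \<^bold>, Scal t) = (x \<^bold>, Scal s \<^bold>, Scal t)"

fun pi1b :: "'k ring \<Rightarrow> ('k, ('v, 'k) tup) module \<Rightarrow> ('v, 'k) tup \<Rightarrow> ('v, 'k) tup" where
  "pi1b K E (x \<^bold>, v \<^bold>, Scal s \<^bold>, Scal t) = (x \<oplus>\<^bsub>E\<^esub> (s \<otimes>\<^bsub>K\<^esub> t) \<odot>\<^bsub>E\<^esub> v \<^bold>, Scal s \<^bold>, Scal t)"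

fun pi_untb :: "('k, ('v, 'k) tup) module \<Rightarrow> ('v, 'k) tup \<Rightarrow> ('v, 'k) tup" where
  "pi_untb E (x \<^bold>, Scal s \<^bold>, Scal t) = (x \<^bold>, \<zero>\<^bsub>E\<^esub> \<^bold>, Scal s \<^bold>, Scal t)"

fun pi_prdb :: "('k, ('v, 'k) tup) module \<Rightarrow> ('v, 'k) tup \<Rightarrow> ('v, 'k) tup \<Rightarrow> ('v, 'k) tup" where
  "pi_prdb E (x' \<^bold>, v' \<^bold>, Scal s' \<^bold>, Scal t') (x \<^bold>, v \<^bold>, Scal s \<^bold>, Scal t) =
     (x \<^bold>, v \<oplus>\<^bsub>E\<^esub> v' \<^bold>, Scal s \<^bold>, Scal t)"

definition Gfi1b ::
  "'k ring \<Rightarrow> ('k, ('v, 'k) tup) module \<Rightarrow> ('v, 'k) tup set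
    \<Rightarrow> (('v, 'k) tup, ('v, 'k) tup) small_cat" where
  "Gfi1b K E X = \<lparr>Obj = ptsb K E X, Mor = incsb K E X,
     src = pi0b, tgt = pi1b K E, unt = pi_untb E, prd = pi_prdb E\<rparr>"

text \<open>The structure maps in direction \<open>k'\<close>, on the edges starting at the empty set and at \<open>{k}\<close>.\<close>

fun del0 :: "'k ring \<Rightarrow> ('v, 'k) tup \<Rightarrow> ('v, 'k) tup" where
  "del0 K (x \<^bold>, Scal s \<^bold>, Scal t) = (x \<^bold>, Scal (s \<otimes>\<^bsub>K\<^esub> t))"

fun del1 :: "('v, 'k) tup \<Rightarrow> ('v, 'k) tup" where
  "del1 (x \<^bold>, Scal s \<^bold>, Scal t) = (x \<^bold>, Scal t)"

fun del_unt :: "'k ring \<Rightarrow> ('v, 'k) tup \<Rightarrow> ('v, 'k) tup" where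
  "del_unt K (x \<^bold>, Scal t) = (x \<^bold>, Scal \<one>\<^bsub>K\<^esub> \<^bold>, Scal t)"

fun del_prd :: "'k ring \<Rightarrow> ('v, 'k) tup \<Rightarrow> ('v, 'k) tup \<Rightarrow> ('v, 'k) tup" where
  "del_prd K (x' \<^bold>, Scal s' \<^bold>, Scal t') (x \<^bold>, Scal s \<^bold>, Scal t) =
     (x \<^bold>, Scal (s \<otimes>\<^bsub>K\<^esub> s') \<^bold>, Scal t')"

definition Gfi1' ::
  "'k ring \<Rightarrow> ('k, ('v, 'k) tup) module \<Rightarrow> ('v, 'k) tup set
    \<Rightarrow> (('v, 'k) tup, ('v, 'k) tup) small_cat" where
  "Gfi1' K E X = \<lparr>Obj = pts K E X, Mor = ptsb K E X,
     src = del0 K, tgt = del1, unt = del_unt K, prd = del_prd K\<rparr>"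

fun del0b :: "'k ring \<Rightarrow> ('v, 'k) tup \<Rightarrow> ('v, 'k) tup" where
  "del0b K (x \<^bold>, v \<^bold>, Scal s \<^bold>, Scal t) = (x \<^bold>, v \<^bold>, Scal (s \<otimes>\<^bsub>K\<^esub> t))"

fun del1b :: "('k, ('v, 'k) tup) module \<Rightarrow> ('v, 'k) tup \<Rightarrow> ('v, 'k) tup" where
  "del1b E (x \<^bold>, v \<^bold>, Scal s \<^bold>, Scal t) = (x \<^bold>, s \<odot>\<^bsub>E\<^esub> v \<^bold>, Scal t)"

fun del_untb :: "'k ring \<Rightarrow> ('v, 'k) tup \<Rightarrow> ('v, 'k) tup" where
  "del_untb K (x \<^bold>, v \<^bold>, Scal t) = (x \<^bold>, v \<^bold>, Scal \<one>\<^bsub>K\<^esub> \<^bold>, Scal t)"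

fun del_prdb :: "'k ring \<Rightarrow> ('v, 'k) tup \<Rightarrow> ('v, 'k) tup \<Rightarrow> ('v, 'k) tup" where
  "del_prdb K (x' \<^bold>, v' \<^bold>, Scal s' \<^bold>, Scal t') (x \<^bold>, v \<^bold>, Scal s \<^bold>, Scal t) =
     (x \<^bold>, v \<^bold>, Scal (s \<otimes>\<^bsub>K\<^esub> s') \<^bold>, Scal t')"

definition Gfi1b' ::
  "'k ring \<Rightarrow> ('k, ('v, 'k) tup) module \<Rightarrow> ('v, 'k) tup set
    \<Rightarrow> (('v, 'k) tup, ('v, 'k) tup) small_cat" where
  "Gfi1b' K E X = \<lparr>Obj = incs K E X, Mor = incsb K E X,
     src = del0b K, tgt = del1b E, unt = del_untb K, prd = del_prdb K\<rparr>"


section \<open>Derived maps and derived categories\<close>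

text \<open>For a map \<open>h\<close> from a subset of \<open>E\<close> to a subset of \<open>E'\<close>. The map \<open>times_id\<close> serves both
  for \<open>(x, t)\<close> and for \<open>(x, s, t)\<close>; like \<open>pts\<close> and \<open>ptsb\<close> it takes unused module
  arguments, for uniformity in \<open>derived_cat\<close>.\<close>

fun times_id ::
  "('k, ('v, 'k) tup) module \<Rightarrow> ('k, ('v, 'k) tup) module
    \<Rightarrow> (('v, 'k) tup \<Rightarrow> ('v, 'k) tup) \<Rightarrow> ('v, 'k) tup \<Rightarrow> ('v, 'k) tup" where
  "times_id E E' h (x \<^bold>, r) = (h x \<^bold>, r)"

fun slope ::
  "'k ring \<Rightarrow> ('k, ('v, 'k) tup) module \<Rightarrow> ('k, ('v, 'k) tup) module
    \<Rightarrow> (('v, 'k) tup \<Rightarrow> ('v, 'k) tup) \<Rightarrow> ('v, 'k) tup \<Rightarrow> ('v, 'k) tup" where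
  "slope K E E' h (x \<^bold>, v \<^bold>, Scal t) =
     (h x \<^bold>, inv\<^bsub>K\<^esub> t \<odot>\<^bsub>E'\<^esub> (h (x \<oplus>\<^bsub>E\<^esub> t \<odot>\<^bsub>E\<^esub> v) \<ominus>\<^bsub>E'\<^esub> h x) \<^bold>, Scal t)"

fun slopeb ::
  "'k ring \<Rightarrow> ('k, ('v, 'k) tup) module \<Rightarrow> ('k, ('v, 'k) tup) module
    \<Rightarrow> (('v, 'k) tup \<Rightarrow> ('v, 'k) tup) \<Rightarrow> ('v, 'k) tup \<Rightarrow> ('v, 'k) tup" where
  "slopeb K E E' h (x \<^bold>, v \<^bold>, Scal s \<^bold>, Scal t) =
     (h x \<^bold>,
      inv\<^bsub>K\<^esub> (s \<otimes>\<^bsub>K\<^esub> t) \<odot>\<^bsub>E'\<^esub> (h (x \<oplus>\<^bsub>E\<^esub> (s \<otimes>\<^bsub>K\<^esub> t) \<odot>\<^bsub>E\<^esub> v) \<ominus>\<^bsub>E'\<^esub> h x) \<^bold>,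
      Scal s \<^bold>, Scal t)"

text \<open>The product of a category with morphism set in \<open>E\<close> is a map on a subset of \<open>E \<times> E\<close>, and is
  derived as such. A pair of elements \<open>(x', v', r)\<close>, \<open>(x, v, r)\<close> that is composable for the
  derived projections is read as the element \<open>((x', x), (v', v), r)\<close>; similarly without \<open>v', v\<close>.\<close>

fun regroup_pt :: "('v, 'k) tup \<Rightarrow> ('v, 'k) tup \<Rightarrow> ('v, 'k) tup" where
  "regroup_pt (x' \<^bold>, r') (x \<^bold>, r) = ((x' \<^bold>, x) \<^bold>, r)"

fun regroup_inc :: "('v, 'k) tup \<Rightarrow> ('v, 'k) tup \<Rightarrow> ('v, 'k) tup" where
  "regroup_inc (x' \<^bold>, v' \<^bold>, r') (x \<^bold>, v \<^bold>, r) = ((x' \<^bold>, x) \<^bold>, (v' \<^bold>, v) \<^bold>, r)"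

text \<open>\<open>S\<close> is the operation on subsets of modules, \<open>T\<close> the operation on maps, \<open>R\<close> the regrouping;
  \<open>Eo\<close>, \<open>Em\<close> are the modules containing the objects and the morphisms of \<open>C\<close>.\<close>

definition derived_cat ::
  "(('k, ('v, 'k) tup) module \<Rightarrow> ('v, 'k) tup set \<Rightarrow> ('v, 'k) tup set)
    \<Rightarrow> (('k, ('v, 'k) tup) module \<Rightarrow> ('k, ('v, 'k) tup) module
          \<Rightarrow> (('v, 'k) tup \<Rightarrow> ('v, 'k) tup) \<Rightarrow> ('v, 'k) tup \<Rightarrow> ('v, 'k) tup)
    \<Rightarrow> (('v, 'k) tup \<Rightarrow> ('v, 'k) tup \<Rightarrow> ('v, 'k) tup)
    \<Rightarrow> ('k, ('v, 'k) tup) module \<Rightarrow> ('k, ('v, 'k) tup) module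
    \<Rightarrow> (('v, 'k) tup, ('v, 'k) tup) small_cat \<Rightarrow> (('v, 'k) tup, ('v, 'k) tup) small_cat" where
  "derived_cat S T R Eo Em C =
     \<lparr>Obj = S Eo (Obj C), Mor = S Em (Mor C),
      src = T Em Eo (src C), tgt = T Em Eo (tgt C), unt = T Eo Em (unt C),
      prd = (\<lambda>g' g. T (Em \<times>\<^sub>m Em) Em (\<lambda>p. prd C (tfst p) (tsnd p)) (R g' g))\<rparr>"


section \<open>The n-fold groupoids\<close>

primrec ambient :: "'k ring \<Rightarrow> ('k, 'v) module \<Rightarrow> nat \<Rightarrow> nat set \<Rightarrow> ('k, ('v, 'k) tup) module" where
  "ambient K V 0 = (\<lambda>\<alpha>. vec_module V)"
| "ambient K V (Suc n) = (\<lambda>\<alpha>.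
     let E = ambient K V n (\<alpha> - {Suc n})
     in if Suc n \<in> \<alpha> then E \<times>\<^sub>m E \<times>\<^sub>m scal_module K else E \<times>\<^sub>m scal_module K)"

primrec Gfi :: "'k ring \<Rightarrow> 'v set \<Rightarrow> ('k, 'v) module \<Rightarrow> nat \<Rightarrow> (nat, ('v, 'k) tup) mfold" where
  "Gfi K U V 0 = \<lparr>index = {}, vertex = (\<lambda>\<alpha>. Vec ` U), edge = undefined\<rparr>"
| "Gfi K U V (Suc n) =
     \<lparr>index = {1..Suc n},
      vertex = (\<lambda>\<alpha>.
        let \<gamma> = \<alpha> - {Suc n}; E = ambient K V n \<gamma>; X = vertex (Gfi K U V n) \<gamma>
        in if Suc n \<in> \<alpha> then incs K E X else pts K E X),
      edge = (\<lambda>\<beta> i.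
        let \<gamma> = \<beta> - {Suc n}; E = ambient K V n \<gamma>; X = vertex (Gfi K U V n) \<gamma>
        in if i = Suc n then Gfi1 K E X
        else
          let Em = ambient K V n (insert i \<gamma>); C = edge (Gfi K U V n) \<gamma> i
          in if Suc n \<in> \<beta> then derived_cat (incs K) (slope K) regroup_inc E Em C
          else derived_cat (pts K) times_id regroup_pt E Em C)\<rparr>"

definition compatible ::
  "'k ring \<Rightarrow> 'v set \<Rightarrow> ('k, 'v) module
    \<Rightarrow> (nat \<Rightarrow> nat set \<Rightarrow> ('v, 'k) tup \<Rightarrow> ('w, 'k) tup) \<Rightarrow> bool" where
  "compatible K U V F \<longleftrightarrow>
     (\<forall>n. \<forall>\<alpha>\<subseteq>index (Gfi K U V n). \<forall>x\<in>vertex (Gfi K U V n) \<alpha>. \<forall>t\<in>Units K.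
        F (Suc n) \<alpha> (x \<^bold>, Scal t) = (F n \<alpha> x \<^bold>, Scal t))"


section \<open>The 2n-fold categories\<close>

text \<open>\<open>Plain k\<close> and \<open>Primed k\<close> are the indices \<open>k\<close> and \<open>k'\<close>.\<close>

datatype dir = Plain nat | Primed nat

primrec ambientb :: "'k ring \<Rightarrow> ('k, 'v) module \<Rightarrow> nat \<Rightarrow> dir set \<Rightarrow> ('k, ('v, 'k) tup) module" where
  "ambientb K V 0 = (\<lambda>\<alpha>. vec_module V)"
| "ambientb K V (Suc n) = (\<lambda>\<alpha>.
     let E = ambientb K V n (\<alpha> - {Plain (Suc n), Primed (Suc n)}); L = scal_module K
     in if Plain (Suc n) \<in> \<alpha>
        then (if Primed (Suc n) \<in> \<alpha> then E \<times>\<^sub>m E \<times>\<^sub>m L \<times>\<^sub>m L else E \<times>\<^sub>m E \<times>\<^sub>m L)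
        else (if Primed (Suc n) \<in> \<alpha> then E \<times>\<^sub>m L \<times>\<^sub>m L else E \<times>\<^sub>m L))"

primrec Gfib :: "'k ring \<Rightarrow> 'v set \<Rightarrow> ('k, 'v) module \<Rightarrow> nat \<Rightarrow> (dir, ('v, 'k) tup) mfold" where
  "Gfib K U V 0 = \<lparr>index = {}, vertex = (\<lambda>\<alpha>. Vec ` U), edge = undefined\<rparr>"
| "Gfib K U V (Suc n) =
     \<lparr>index = Plain ` {1..Suc n} \<union> Primed ` {1..Suc n},
      vertex = (\<lambda>\<alpha>.
        let \<gamma> = \<alpha> - {Plain (Suc n), Primed (Suc n)};
            E = ambientb K V n \<gamma>; X = vertex (Gfib K U V n) \<gamma>
        in if Plain (Suc n) \<in> \<alpha>
           then (if Primed (Suc n) \<in> \<alpha> then incsb K E X else incs K E X)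
           else (if Primed (Suc n) \<in> \<alpha> then ptsb K E X else pts K E X)),
      edge = (\<lambda>\<beta> i.
        let \<gamma> = \<beta> - {Plain (Suc n), Primed (Suc n)};
            E = ambientb K V n \<gamma>; X = vertex (Gfib K U V n) \<gamma>
        in if i = Plain (Suc n) then (if Primed (Suc n) \<in> \<beta> then Gfi1b K E X else Gfi1 K E X)
        else if i = Primed (Suc n) then (if Plain (Suc n) \<in> \<beta> then Gfi1b' K E X else Gfi1' K E X)
        else
          let Em = ambientb K V n (insert i \<gamma>); C = edge (Gfib K U V n) \<gamma> i
          in if Plain (Suc n) \<in> \<beta>
             then (if Primed (Suc n) \<in> \<beta>
                   then derived_cat (incsb K) (slopeb K) regroup_inc E Em C
                   else derived_cat (incs K) (slope K) regroup_inc E Em C)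
             else (if Primed (Suc n) \<in> \<beta>
                   then derived_cat (ptsb K) times_id regroup_pt E Em C
                   else derived_cat (pts K) times_id regroup_pt E Em C))\<rparr>"

definition compatibleb ::
  "'k ring \<Rightarrow> 'v set \<Rightarrow> ('k, 'v) module
    \<Rightarrow> (nat \<Rightarrow> dir set \<Rightarrow> ('v, 'k) tup \<Rightarrow> ('w, 'k) tup) \<Rightarrow> bool" where
  "compatibleb K U V F \<longleftrightarrow>
     (\<forall>n. \<forall>\<alpha>\<subseteq>index (Gfib K U V n). \<forall>x\<in>vertex (Gfib K U V n) \<alpha>. \<forall>t\<in>Units K.
        F (Suc n) \<alpha> (x \<^bold>, Scal t) = (F n \<alpha> x \<^bold>, Scal t))"

end

theory Submission
  imports Defs
begin

text \<open>On subsets of modules with arbitrary maps, each of the four vertex constructions is a functor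
  \<open>dset\<close>, \<open>dmap\<close>: an increment \<open>(x, v, r)\<close> is determined by \<open>r\<close> and its two endpoints, since \<open>r\<close> acts
  invertibly, and \<open>dmap h\<close> applies \<open>h\<close> to both endpoints. For the same reason these functors preserve
  fibre products, hence turn categories, functors and double categories into such. The structure maps
  of the new directions are natural transformations between them; naturality with respect to the old
  structure maps gives the faces between an old and a new direction, and naturality with respect to
  \<open>f\<close> gives the morphisms. Uniqueness holds because a functor on a new edge is determined on morphisms by
  its effect on source and target.\<close>

section \<open>Difference quotients in modules\<close>

text \<open>The hard structure map is the product. It is defined on composable pairs, so it is
  derived as a map on a subset of E x E, whereas a pair composable in the derived category consists
  of two increments of which only a derived source and a derived target are known to agree. That
  such a pair is the same as one increment of the set of composable pairs is the content of
  \<open>regroup_pullback\<close>: equal difference quotients at a common base point must have equal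
  endpoints. Associativity uses this again for triples, the interchange law for 2 x 2 arrays. The
  n-fold groupoids are the part of the 2n-fold categories over vertices without primed directions,
  so one treatment with flags a, b serves both. Structure maps keep the type of vectors while f
  changes it; hence the relabelling u in \<open>dmap\<close>, which is \<open>id\<close> or f.
  Compatibility prescribes a morphism only at vertices free of the new directions. The others are
  reached along new edges, {k,k'} being reached from {k'} in direction k.\<close>

definition quot :: "'k ring \<Rightarrow> ('k, 'v) module \<Rightarrow> 'k \<Rightarrow> 'v \<Rightarrow> 'v \<Rightarrow> 'v" where
  "quot K E c y z = inv\<^bsub>K\<^esub> c \<odot>\<^bsub>E\<^esub> (z \<ominus>\<^bsub>E\<^esub> y)"

lemma (in abelian_group) add_minus_cancel:
  assumes "y \<in> carrier G" "z \<in> carrier G"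
  shows "y \<oplus> (z \<ominus> y) = z"
proof -
  have "y \<oplus> (z \<oplus> \<ominus> y) = z \<oplus> (y \<oplus> \<ominus> y)"
    by (rule a_lcomm) (use assms in auto)
  then show ?thesis
    using assms by (simp add: minus_eq r_neg)
qed

lemma (in abelian_group) minus_add_cancel:
  assumes "y \<in> carrier G" "z \<in> carrier G"
  shows "(y \<oplus> z) \<ominus> y = z"
  using assms add_minus_cancel[OF assms] by (simp add: minus_eq a_assoc)

context
  fixes K :: "'k ring" and E :: "('k, 'v) module"
  assumes E: "module K E"
begin

interpretation module K E by (fact E)

lemma quot_closed [simp]:
  "c \<in> Units K \<Longrightarrow> y \<in> carrier E \<Longrightarrow> z \<in> carrier E \<Longrightarrow> quot K E c y z \<in> carrier E"
  by (simp add: quot_def)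

lemma add_smult_quot [simp]:
  assumes "c \<in> Units K" "y \<in> carrier E" "z \<in> carrier E"
  shows "y \<oplus>\<^bsub>E\<^esub> c \<odot>\<^bsub>E\<^esub> quot K E c y z = z"
  using assms
  by (simp add: quot_def smult_assoc1[symmetric] R.Units_closed M.add_minus_cancel)

lemma quot_add_smult [simp]:
  assumes "c \<in> Units K" "y \<in> carrier E" "w \<in> carrier E"
  shows "quot K E c y (y \<oplus>\<^bsub>E\<^esub> c \<odot>\<^bsub>E\<^esub> w) = w"
  using assms
  by (simp add: quot_def smult_assoc1[symmetric] R.Units_closed M.minus_add_cancel)

text \<open>For a unit c the equation y + c w = z has exactly one solution w. Identities between
  difference quotients are proved by exhibiting a solution of this equation, without computing with
  inverses.\<close>

lemma quot_eqI:
  assumes "c \<in> Units K" "y \<in> carrier E" "w \<in> carrier E" "y \<oplus>\<^bsub>E\<^esub> c \<odot>\<^bsub>E\<^esub> w = z"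
  shows "quot K E c y z = w"
  using assms by auto

end

section \<open>Module structures on nested tuples\<close>

lemma module_prod_module:
  fixes M N :: "('k, ('v, 'k) tup) module"
  assumes "module K M" "module K N"
  shows "module K (M \<times>\<^sub>m N)"
proof -
  interpret M: module K M by fact
  interpret N: module K N by fact
  show ?thesis
  proof (rule moduleI)
    show "abelian_group (M \<times>\<^sub>m N)"
    proof (rule abelian_groupI)
      fix x assume "x \<in> carrier (M \<times>\<^sub>m N)"
      then obtain p q where "x = (p \<^bold>, q)" "p \<in> carrier M" "q \<in> carrier N"
        by (auto simp: prod_module_def)
      then show "\<exists>y\<in>carrier (M \<times>\<^sub>m N). y \<oplus>\<^bsub>M \<times>\<^sub>m N\<^esub> x = \<zero>\<^bsub>M \<times>\<^sub>m N\<^esub>"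
        by (intro bexI[of _ "(\<ominus>\<^bsub>M\<^esub> p \<^bold>, \<ominus>\<^bsub>N\<^esub> q)"]) (auto simp: prod_module_def M.M.l_neg N.M.l_neg)
    qed (auto simp: prod_module_def M.M.a_ac N.M.a_ac)
  qed (auto simp: prod_module_def M.smult_l_distr N.smult_l_distr M.smult_r_distr N.smult_r_distr
        M.smult_assoc1 N.smult_assoc1 M.R.is_cring)
qed

lemma module_vec_module:
  assumes "module K V"
  shows "module K (vec_module V :: ('k, ('v, 'k) tup) module)"
proof -
  interpret module K V by fact
  show ?thesis
  proof (rule moduleI)
    show "abelian_group (vec_module V :: ('k, ('v, 'k) tup) module)"
    proof (rule abelian_groupI)
      fix x assume "x \<in> carrier (vec_module V :: ('k, ('v, 'k) tup) module)"
      then obtain p where "x = Vec p" "p \<in> carrier V"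
        by (auto simp: vec_module_def)
      then show "\<exists>y\<in>carrier (vec_module V). y \<oplus>\<^bsub>vec_module V\<^esub> x = \<zero>\<^bsub>vec_module V\<^esub>"
        by (intro bexI[of _ "Vec (\<ominus>\<^bsub>V\<^esub> p)"]) (auto simp: vec_module_def M.l_neg)
    qed (auto simp: vec_module_def M.a_ac)
  qed (auto simp: vec_module_def smult_l_distr smult_r_distr smult_assoc1 R.is_cring)
qed

lemma module_scal_module:
  assumes "cring K"
  shows "module K (scal_module K :: ('k, ('v, 'k) tup) module)"
proof -
  interpret cring K by fact
  show ?thesis
  proof (rule moduleI)
    show "abelian_group (scal_module K :: ('k, ('v, 'k) tup) module)"
    proof (rule abelian_groupI)
      fix x assume "x \<in> carrier (scal_module K :: ('k, ('v, 'k) tup) module)"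
      then obtain p where "x = Scal p" "p \<in> carrier K"
        by (auto simp: scal_module_def)
      then show "\<exists>y\<in>carrier (scal_module K). y \<oplus>\<^bsub>scal_module K\<^esub> x = \<zero>\<^bsub>scal_module K\<^esub>"
        by (intro bexI[of _ "Scal (\<ominus>\<^bsub>K\<^esub> p)"]) (auto simp: scal_module_def l_neg)
    qed (auto simp: scal_module_def a_ac)
  qed (auto simp: scal_module_def l_distr r_distr m_assoc is_cring)
qed

section \<open>The four vertex functors\<close>

definition scalars :: "'k ring \<Rightarrow> bool \<Rightarrow> ('v, 'k) tup set" where
  "scalars K b = (if b then {(Scal s \<^bold>, Scal t) | s t. s \<in> Units K \<and> t \<in> Units K}
                  else Scal ` Units K)"

text \<open>The scalar by which an increment is really multiplied: t at {k}, and st at {k,k'}.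
  Through it the construction at {k,k'} looks like the one at {k} with another unit.\<close>

fun eff :: "'k ring \<Rightarrow> ('v, 'k) tup \<Rightarrow> 'k" where
  "eff K (Scal t) = t"
| "eff K (Scal s \<^bold>, Scal t) = s \<otimes>\<^bsub>K\<^esub> t"

text \<open>In \<open>dset K a b\<close> the flags \<open>a\<close> and \<open>b\<close> tell whether the vertex contains \<open>k\<close> and \<open>k'\<close>.\<close>

definition dset :: "'k ring \<Rightarrow> bool \<Rightarrow> bool \<Rightarrow> ('k, ('v, 'k) tup) module \<Rightarrow> ('v, 'k) tup set
    \<Rightarrow> ('v, 'k) tup set" where
  "dset K a b = (if a then (if b then incsb K else incs K) else (if b then ptsb K else pts K))"

definition dmod :: "'k ring \<Rightarrow> bool \<Rightarrow> bool \<Rightarrow> ('k, ('v, 'k) tup) module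
    \<Rightarrow> ('k, ('v, 'k) tup) module" where
  "dmod K a b E = (let L = scal_module K in
     if a then (if b then E \<times>\<^sub>m E \<times>\<^sub>m L \<times>\<^sub>m L else E \<times>\<^sub>m E \<times>\<^sub>m L)
     else (if b then E \<times>\<^sub>m L \<times>\<^sub>m L else E \<times>\<^sub>m L))"

text \<open>The map \<open>u\<close> only adapts the type of the scalars \<open>r\<close>, in which no vector occurs.\<close>

fun dmap :: "('v \<Rightarrow> 'w) \<Rightarrow> 'k ring \<Rightarrow> bool \<Rightarrow> bool \<Rightarrow> ('k, ('v, 'k) tup) module
    \<Rightarrow> ('k, ('w, 'k) tup) module \<Rightarrow> (('v, 'k) tup \<Rightarrow> ('w, 'k) tup) \<Rightarrow> ('v, 'k) tup \<Rightarrow> ('w, 'k) tup"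
  where
  "dmap u K False b E E' h (x \<^bold>, r) = (h x \<^bold>, map_tup u id r)"
| "dmap u K True False E E' h (x \<^bold>, v \<^bold>, Scal t) =
     (h x \<^bold>, quot K E' t (h x) (h (x \<oplus>\<^bsub>E\<^esub> t \<odot>\<^bsub>E\<^esub> v)) \<^bold>, Scal t)"
| "dmap u K True True E E' h (x \<^bold>, v \<^bold>, Scal s \<^bold>, Scal t) =
     (h x \<^bold>, quot K E' (s \<otimes>\<^bsub>K\<^esub> t) (h x) (h (x \<oplus>\<^bsub>E\<^esub> (s \<otimes>\<^bsub>K\<^esub> t) \<odot>\<^bsub>E\<^esub> v)) \<^bold>, Scal s \<^bold>, Scal t)"

definition regroup :: "bool \<Rightarrow> ('v, 'k) tup \<Rightarrow> ('v, 'k) tup \<Rightarrow> ('v, 'k) tup" where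
  "regroup a = (if a then regroup_inc else regroup_pt)"

text \<open>An equality of total functions, as are the two after it, because the maps occur
  unapplied as arguments of \<open>derived_cat\<close>. On tuples of the wrong shape both sides are
  \<open>undefined\<close>; on tuples of the right shape the relabelling by \<open>id\<close>
  disappears.\<close>

lemma dmap_eq_times_id: "dmap id K False b = times_id"
proof (intro ext)
  fix E E' h p
  show "dmap id K False b E E' h p = times_id E E' h p"
    by (rule dmap.elims[OF refl, of id K False b E E' h p];
        rule times_id.elims[OF refl, of E E' h p]; simp add: tup.map_id)
qed

lemma dmap_eq_slope: "dmap id K True False = slope K"
proof (intro ext)
  fix E E' h p
  show "dmap id K True False E E' h p = slope K E E' h p"
  proof (cases "\<exists>x v t. p = (x \<^bold>, v \<^bold>, Scal t)")
    case False
    have "dmap id K True False E E' h p = undefined"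
      by (rule dmap.elims[OF refl, of id K True False E E' h p]) (use False in simp_all)
    moreover have "slope K E E' h p = undefined"
      by (rule slope.elims[OF refl, of K E E' h p]) (use False in simp_all)
    ultimately show ?thesis by simp
  qed (auto simp: quot_def)
qed

lemma dmap_eq_slopeb: "dmap id K True True = slopeb K"
proof (intro ext)
  fix E E' h p
  show "dmap id K True True E E' h p = slopeb K E E' h p"
  proof (cases "\<exists>x v s t. p = (x \<^bold>, v \<^bold>, Scal s \<^bold>, Scal t)")
    case False
    have "dmap id K True True E E' h p = undefined"
      by (rule dmap.elims[OF refl, of id K True True E E' h p]) (use False in simp_all)
    moreover have "slopeb K E E' h p = undefined"
      by (rule slopeb.elims[OF refl, of K E E' h p]) (use False in simp_all)
    ultimately show ?thesis by simp
  qed (auto simp: quot_def)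
qed

lemma dset_False: "dset K False b E X = {(x \<^bold>, r) | x r. x \<in> X \<and> r \<in> scalars K b}"
  by (auto simp: dset_def pts_def ptsb_def scalars_def)

text \<open>With \<open>scalars\<close> and \<open>eff\<close> one description covers both values of
  b, so that the arguments below split only on the flag a.\<close>

lemma dset_True: "dset K True b E X =
    {(x \<^bold>, v \<^bold>, r) | x v r. x \<in> X \<and> v \<in> carrier E \<and> r \<in> scalars K b \<and> x \<oplus>\<^bsub>E\<^esub> eff K r \<odot>\<^bsub>E\<^esub> v \<in> X}"
  by (fastforce simp: dset_def incs_def incsb_def scalars_def)

lemmas dset_simps = dset_False dset_True

lemma dmap_True: "r \<in> scalars K b \<Longrightarrow> dmap u K True b E E' h (x \<^bold>, v \<^bold>, r) =
    (h x \<^bold>, quot K E' (eff K r) (h x) (h (x \<oplus>\<^bsub>E\<^esub> eff K r \<odot>\<^bsub>E\<^esub> v)) \<^bold>, map_tup u id r)"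
  by (auto simp: scalars_def split: if_splits)

lemma recast_scalars [simp]: "r \<in> scalars K b \<Longrightarrow> map_tup u id r \<in> scalars K b"
  by (auto simp: scalars_def)

lemma eff_recast [simp]: "r \<in> scalars K b \<Longrightarrow> eff K (map_tup u id r) = eff K r"
  by (auto simp: scalars_def split: if_splits)

text \<open>Scalars contain no \<open>Vec\<close>, so the relabellings u, w and z are unrelated.
  This allows a derived structure map, relabelled by \<open>id\<close>, to be interchanged with a
  map derived from f, relabelled by f.\<close>

lemma recast_recast: "r \<in> scalars K b \<Longrightarrow> map_tup u id (map_tup w id r) = map_tup z id r"
  by (auto simp: scalars_def split: if_splits)

lemma recast_id: "map_tup id id r = r"
  by (simp add: tup.map_id)

lemma linear_set_module [dest]: "linear_set K X E \<Longrightarrow> module K E"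
  by (simp add: linear_set_def)

lemma linear_set_carrier: "linear_set K X E \<Longrightarrow> x \<in> X \<Longrightarrow> x \<in> carrier E"
  by (auto simp: linear_set_def)

lemma prod_simps [simp]:
  "carrier (M \<times>\<^sub>m N) = {(x \<^bold>, y) | x y. x \<in> carrier M \<and> y \<in> carrier N}"
  "\<zero>\<^bsub>M \<times>\<^sub>m N\<^esub> = (\<zero>\<^bsub>M\<^esub> \<^bold>, \<zero>\<^bsub>N\<^esub>)"
  "(x \<^bold>, y) \<oplus>\<^bsub>M \<times>\<^sub>m N\<^esub> (x' \<^bold>, y') = (x \<oplus>\<^bsub>M\<^esub> x' \<^bold>, y \<oplus>\<^bsub>N\<^esub> y')"
  "c \<odot>\<^bsub>M \<times>\<^sub>m N\<^esub> (x \<^bold>, y) = (c \<odot>\<^bsub>M\<^esub> x \<^bold>, c \<odot>\<^bsub>N\<^esub> y)"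
  by (auto simp: prod_module_def)

lemma linear_set_prod:
  assumes "linear_set K X M" "linear_set K Y N" "Z \<subseteq> {(x \<^bold>, y) | x y. x \<in> X \<and> y \<in> Y}"
  shows "linear_set K Z (M \<times>\<^sub>m N)"
  using assms by (fastforce simp: linear_set_def module_prod_module)

text \<open>The component y' comes first to match the order of factors in a product
  \<open>g' * g\<close>: with the source for g and the target for f this is the set of composable
  pairs.\<close>

definition pullback :: "('v, 'k) tup set \<Rightarrow> ('v, 'k) tup set \<Rightarrow> (('v, 'k) tup \<Rightarrow> 'c)
    \<Rightarrow> (('v, 'k) tup \<Rightarrow> 'c) \<Rightarrow> ('v, 'k) tup set" where
  "pullback Y' Y g f = {(y' \<^bold>, y) | y' y. y' \<in> Y' \<and> y \<in> Y \<and> f y = g y'}"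

lemma pullback_iff: "(y' \<^bold>, y) \<in> pullback Y' Y g f \<longleftrightarrow> y' \<in> Y' \<and> y \<in> Y \<and> f y = g y'"
  by (auto simp: pullback_def)

locale unital_scalars = cring K for K :: "'k ring"
begin

lemma eff_Units: "r \<in> scalars K b \<Longrightarrow> eff K r \<in> Units K"
  by (auto simp: scalars_def split: if_splits)

lemma module_dmod: "module K E \<Longrightarrow> module K (dmod K a b E)"
  by (auto simp: dmod_def Let_def intro!: module_prod_module module_scal_module is_cring)

text \<open>This is what allows the construction to be iterated: a vertex set of the next level is
  again a subset of a module.\<close>

lemma linear_set_dset:
  assumes "linear_set K X E"
  shows "linear_set K (dset K a b E X) (dmod K a b E)"
  unfolding linear_set_def
proof (intro conjI module_dmod)
  show "dset K a b E X \<subseteq> carrier (dmod K a b E)"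
    using assms
    by (cases a; cases b)
       (auto simp: dset_simps dmod_def scalars_def scal_module_def linear_set_def Units_closed)
qed (use assms in auto)

text \<open>By \<open>add_smult_quot\<close> the endpoint of the image increment is h of the old
  endpoint, which lies in X'.\<close>

lemma dmap_in:
  assumes "linear_set K X E" "linear_set K X' E'" "h \<in> X \<rightarrow> X'" "p \<in> dset K a b E X"
  shows "dmap u K a b E E' h p \<in> dset K a b E' X'"
proof -
  show ?thesis
    using assms(1,3,4) funcset_mem[OF assms(3)] linear_set_carrier[OF assms(2)]
      linear_set_module[OF assms(2)]
    by (cases a) (auto simp: dset_simps dmap_True eff_Units)
qed

text \<open>The chain rule in exact form. The intermediate increment starts at h x and ends at h of
  the old endpoint, so g is evaluated at precisely the points where the composite is.\<close>

lemma dmap_comp: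
  assumes "linear_set K X E" "linear_set K X' E'" "h \<in> X \<rightarrow> X'" "p \<in> dset K a b E X"
  shows "dmap w K a b E' E'' g (dmap u K a b E E' h p) = dmap z K a b E E'' (\<lambda>x. g (h x)) p"
  using assms(1,3,4) funcset_mem[OF assms(3)] linear_set_carrier[OF assms(2)]
    linear_set_module[OF assms(2)]
  by (cases a) (auto simp: dset_simps dmap_True eff_Units recast_recast[of _ K b w u z])

text \<open>A derived map looks at h only at the base point and the endpoint of an increment, and
  both belong to X.\<close>

lemma dmap_cong:
  assumes "p \<in> dset K a b E X" "\<And>x. x \<in> X \<Longrightarrow> h x = h' x"
  shows "dmap u K a b E E' h p = dmap u K a b E E' h' p"
  using assms by (cases a) (auto simp: dset_simps dmap_True)

lemma dmap_ident:
  assumes "linear_set K X E" "p \<in> dset K a b E X" "\<And>x. x \<in> X \<Longrightarrow> h x = x"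
  shows "dmap id K a b E E h p = p"
  using assms linear_set_carrier[OF assms(1)] linear_set_module[OF assms(1)]
  by (cases a) (auto simp: dset_simps dmap_True eff_Units recast_id)

text \<open>Operations in a product module are componentwise, so the quotient of a pair is the pair
  of quotients. It turns the two arguments of a derived product, once they are derived from a common
  element p, into a single derived map of p.\<close>

lemma regroup_dmap:
  assumes "linear_set K X E" "linear_set K Y E1" "linear_set K Y' E2" "f \<in> X \<rightarrow> Y" "g \<in> X \<rightarrow> Y'"
    and "p \<in> dset K a b E X"
  shows "regroup a (dmap u K a b E E1 f p) (dmap u K a b E E2 g p)
       = dmap u K a b E (E1 \<times>\<^sub>m E2) (\<lambda>x. f x \<^bold>, g x) p"
proof -
  interpret E1: module K E1 using assms(2) by blast
  interpret E2: module K E2 using assms(3) by blast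
  have P: "module K (E1 \<times>\<^sub>m E2)"
    by (simp add: module_prod_module E1.module_axioms E2.module_axioms)
  have q: "quot K (E1 \<times>\<^sub>m E2) c (y \<^bold>, y') (z \<^bold>, z') = (quot K E1 c y z \<^bold>, quot K E2 c y' z')"
    if "c \<in> Units K" "y \<in> carrier E1" "z \<in> carrier E1" "y' \<in> carrier E2" "z' \<in> carrier E2"
    for c y z y' z'
    by (rule quot_eqI[OF P]) (use that in \<open>auto simp: E1.module_axioms E2.module_axioms\<close>)
  show ?thesis
    using assms(6) funcset_mem[OF assms(4)] funcset_mem[OF assms(5)]
      linear_set_carrier[OF assms(2)] linear_set_carrier[OF assms(3)]
    by (cases a) (auto simp: dset_simps dmap_True eff_Units regroup_def q)
qed

text \<open>The functor preserves fibre products, with \<open>regroup\<close> inverse to the pair of derived projections.\<close>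

lemma regroup_pullback:
  assumes "linear_set K Y' E'" "linear_set K Y E" "linear_set K Z E''" "g \<in> Y' \<rightarrow> Z" "f \<in> Y \<rightarrow> Z"
    and "p' \<in> dset K a b E' Y'" "p \<in> dset K a b E Y"
    and "dmap id K a b E E'' f p = dmap id K a b E' E'' g p'"
  shows "regroup a p' p \<in> dset K a b (E' \<times>\<^sub>m E) (pullback Y' Y g f)"
    and "dmap id K a b (E' \<times>\<^sub>m E) E' tfst (regroup a p' p) = p'"
    and "dmap id K a b (E' \<times>\<^sub>m E) E tsnd (regroup a p' p) = p"
proof -
  \<comment> \<open>Base point, unit and quotient determine the endpoint; the injectivity of the
    passage from endpoints to increments.\<close>
  have quot_inj: "z = z'"
    if "quot K E'' c y z = quot K E'' c y z'" "c \<in> Units K" "y \<in> Z" "z \<in> Z" "z' \<in> Z" for c y z z'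
    using add_smult_quot[of K E'' c y] that linear_set_module[OF assms(3)]
      linear_set_carrier[OF assms(3)] by metis
  have "regroup a p' p \<in> dset K a b (E' \<times>\<^sub>m E) (pullback Y' Y g f) \<and>
    dmap id K a b (E' \<times>\<^sub>m E) E' tfst (regroup a p' p) = p' \<and>
    dmap id K a b (E' \<times>\<^sub>m E) E tsnd (regroup a p' p) = p"
  proof (cases a)
    case False
    then show ?thesis using assms(6-8)
      by (auto simp: dset_simps regroup_def pullback_def recast_id)
  next
    case True
    then have a: "a = True" by simp
    obtain y' v' r' where p': "p' = (y' \<^bold>, v' \<^bold>, r')" "y' \<in> Y'" "v' \<in> carrier E'" "r' \<in> scalars K b"
      "y' \<oplus>\<^bsub>E'\<^esub> eff K r' \<odot>\<^bsub>E'\<^esub> v' \<in> Y'"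
      using assms(6) unfolding a dset_True by blast
    obtain y v r where p: "p = (y \<^bold>, v \<^bold>, r)" "y \<in> Y" "v \<in> carrier E" "r \<in> scalars K b"
      "y \<oplus>\<^bsub>E\<^esub> eff K r \<odot>\<^bsub>E\<^esub> v \<in> Y"
      using assms(7) unfolding a dset_True by blast
    have e: "(f y \<^bold>, quot K E'' (eff K r) (f y) (f (y \<oplus>\<^bsub>E\<^esub> eff K r \<odot>\<^bsub>E\<^esub> v)) \<^bold>, r) =
      (g y' \<^bold>, quot K E'' (eff K r') (g y') (g (y' \<oplus>\<^bsub>E'\<^esub> eff K r' \<odot>\<^bsub>E'\<^esub> v')) \<^bold>, r')"
      using assms(8) unfolding a p(1) p'(1) dmap_True[OF p(4)] dmap_True[OF p'(4)] recast_id .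
    \<comment> \<open>Derived maps leave the scalars alone, so equal images have equal scalars and
      equal base points.\<close>
    then have r: "r' = r" and fg: "g y' = f y" by simp_all
    \<comment> \<open>Equality of quotients becomes equality of endpoints, which puts the pair of
      endpoints into the fibre product as well.\<close>
    have "f (y \<oplus>\<^bsub>E\<^esub> eff K r \<odot>\<^bsub>E\<^esub> v) = g (y' \<oplus>\<^bsub>E'\<^esub> eff K r \<odot>\<^bsub>E'\<^esub> v')"
    proof (rule quot_inj)
      show "quot K E'' (eff K r) (f y) (f (y \<oplus>\<^bsub>E\<^esub> eff K r \<odot>\<^bsub>E\<^esub> v)) =
          quot K E'' (eff K r) (f y) (g (y' \<oplus>\<^bsub>E'\<^esub> eff K r \<odot>\<^bsub>E'\<^esub> v'))"
        using e unfolding r fg tup.inject by (elim conjE)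
    qed (use assms(4,5) p p' r eff_Units in auto)
    with p(2,5) p'(2,5) fg have pb: "(y' \<^bold>, y) \<in> pullback Y' Y g f"
      "(y' \<oplus>\<^bsub>E'\<^esub> eff K r \<odot>\<^bsub>E'\<^esub> v' \<^bold>, y \<oplus>\<^bsub>E\<^esub> eff K r \<odot>\<^bsub>E\<^esub> v) \<in> pullback Y' Y g f"
      by (simp_all add: pullback_def r)
    have re: "regroup a p' p = ((y' \<^bold>, y) \<^bold>, (v' \<^bold>, v) \<^bold>, r)"
      unfolding p(1) p'(1) by (simp add: regroup_def a r)
    have c: "y \<in> carrier E" "y' \<in> carrier E'"
      using p(2) p'(2) linear_set_carrier[OF assms(1)] linear_set_carrier[OF assms(2)] by blast+
    show ?thesis
      unfolding re using pb p(3,4) p'(3) c unfolding a p(1) p'(1) r dset_True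
      by (simp add: dmap_True[OF p(4)] recast_id eff_Units[OF p(4)]
          linear_set_module[OF assms(1)] linear_set_module[OF assms(2)])
  qed
  then show "regroup a p' p \<in> dset K a b (E' \<times>\<^sub>m E) (pullback Y' Y g f)"
    and "dmap id K a b (E' \<times>\<^sub>m E) E' tfst (regroup a p' p) = p'"
    and "dmap id K a b (E' \<times>\<^sub>m E) E tsnd (regroup a p' p) = p"
    by auto
qed

end

section \<open>Functors and faces\<close>

lemma small_categoryD:
  assumes "small_category C"
  shows "g \<in> Mor C \<Longrightarrow> src C g \<in> Obj C" "g \<in> Mor C \<Longrightarrow> tgt C g \<in> Obj C"
    "x \<in> Obj C \<Longrightarrow> unt C x \<in> Mor C"
    "x \<in> Obj C \<Longrightarrow> src C (unt C x) = x" "x \<in> Obj C \<Longrightarrow> tgt C (unt C x) = x"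
    "(g', g) \<in> composable C \<Longrightarrow> prd C g' g \<in> Mor C"
    "(g', g) \<in> composable C \<Longrightarrow> src C (prd C g' g) = src C g"
    "(g', g) \<in> composable C \<Longrightarrow> tgt C (prd C g' g) = tgt C g'"
    "g \<in> Mor C \<Longrightarrow> prd C g (unt C (src C g)) = g"
    "g \<in> Mor C \<Longrightarrow> prd C (unt C (tgt C g)) g = g"
    "(g'', g') \<in> composable C \<Longrightarrow> (g', g) \<in> composable C \<Longrightarrow>
        prd C g'' (prd C g' g) = prd C (prd C g'' g') g"
  using assms unfolding small_category_def by blast+

lemma composable_iff:
  "(g', g) \<in> composable C \<longleftrightarrow> g' \<in> Mor C \<and> g \<in> Mor C \<and> tgt C g = src C g'"
  by (simp add: composable_def)

lemma is_functorD:
  assumes "is_functor C D Fo Fm"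
  shows "x \<in> Obj C \<Longrightarrow> Fo x \<in> Obj D" "g \<in> Mor C \<Longrightarrow> Fm g \<in> Mor D"
    "g \<in> Mor C \<Longrightarrow> src D (Fm g) = Fo (src C g)" "g \<in> Mor C \<Longrightarrow> tgt D (Fm g) = Fo (tgt C g)"
    "x \<in> Obj C \<Longrightarrow> Fm (unt C x) = unt D (Fo x)"
    "(g', g) \<in> composable C \<Longrightarrow> Fm (prd C g' g) = prd D (Fm g') (Fm g)"
  using assms unfolding is_functor_def by blast+

lemma is_functorI:
  assumes "\<And>x. x \<in> Obj C \<Longrightarrow> Fo x \<in> Obj D" "\<And>g. g \<in> Mor C \<Longrightarrow> Fm g \<in> Mor D"
    "\<And>g. g \<in> Mor C \<Longrightarrow> src D (Fm g) = Fo (src C g)"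
    "\<And>g. g \<in> Mor C \<Longrightarrow> tgt D (Fm g) = Fo (tgt C g)"
    "\<And>x. x \<in> Obj C \<Longrightarrow> Fm (unt C x) = unt D (Fo x)"
    "\<And>g' g. (g', g) \<in> composable C \<Longrightarrow> Fm (prd C g' g) = prd D (Fm g') (Fm g)"
  shows "is_functor C D Fo Fm"
  using assms unfolding is_functor_def by blast

lemma is_functor_comp:
  assumes "is_functor C D Fo Fm" "is_functor D E Go Gm"
  shows "is_functor C E (\<lambda>x. Go (Fo x)) (\<lambda>g. Gm (Fm g))"
proof (rule is_functorI)
  fix g' g assume "(g', g) \<in> composable C"
  moreover from this have "(Fm g', Fm g) \<in> composable D"
    by (simp add: composable_iff is_functorD[OF assms(1)])
  ultimately show "Gm (Fm (prd C g' g)) = prd E (Gm (Fm g')) (Gm (Fm g))"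
    by (simp add: is_functorD[OF assms(1)] is_functorD[OF assms(2)])
qed (simp_all add: is_functorD[OF assms(1)] is_functorD[OF assms(2)])

text \<open>Functoriality involves only values on objects and morphisms. It will be applied to
  restrictions, since morphisms are extensional.\<close>

lemma is_functor_cong:
  assumes "is_functor C D Fo Fm" "small_category C"
    "\<And>x. x \<in> Obj C \<Longrightarrow> Go x = Fo x" "\<And>g. g \<in> Mor C \<Longrightarrow> Gm g = Fm g"
  shows "is_functor C D Go Gm"
  by (rule is_functorI)
     (simp_all add: is_functorD[OF assms(1)] small_categoryD[OF assms(2)] assms(3,4) composable_iff)

text \<open>Functoriality of the structure maps of one direction says that they commute with those of
  the other, a symmetric condition.\<close>

lemma structure_maps_functorial_sym:
  assumes "small_category A" "small_category B" "small_category P" "small_category Q"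
    and eq: "Obj A = Obj P" "Mor A = Obj Q" "Obj B = Mor P" "Mor B = Mor Q"
    and "structure_maps_functorial A B P Q"
  shows "structure_maps_functorial P Q A B"
proof -
  note C = small_categoryD[OF assms(1)] small_categoryD[OF assms(2)]
    small_categoryD[OF assms(3)] small_categoryD[OF assms(4)]
  have F: "is_functor Q P (src A) (src B)" "is_functor Q P (tgt A) (tgt B)"
    "is_functor P Q (unt A) (unt B)"
    "is_functor (composable_cat A B Q) Q (\<lambda>(g', g). prd A g' g) (\<lambda>(g', g). prd B g' g)"
    using assms(9) by (auto simp: structure_maps_functorial_def)
  note S = is_functorD[OF F(1)] note T = is_functorD[OF F(2)] note U = is_functorD[OF F(3)]
  note M = is_functorD[OF F(4), unfolded composable_cat_def, simplified]
  have M1: "src Q (prd B g' g) = prd A (src Q g') (src Q g)"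
    and M2: "tgt Q (prd B g' g) = prd A (tgt Q g') (tgt Q g)" if "(g', g) \<in> composable B" for g' g
    using M(3)[of "(g', g)"] M(4)[of "(g', g)"] that by auto
  have M3: "prd B (unt Q x') (unt Q x) = unt Q (prd A x' x)" if "(x', x) \<in> composable A" for x' x
    using M(5)[of "(x', x)"] that by auto
  \<comment> \<open>The interchange law. Functoriality of either product with respect to the other
    direction is this one equation, with the roles of the factors exchanged.\<close>
  have M4: "prd B (prd Q h' g') (prd Q h g) = prd Q (prd B h' h) (prd B g' g)"
    if "(h', h) \<in> composable B" "(g', g) \<in> composable B" "(h', g') \<in> composable Q"
       "(h, g) \<in> composable Q" for h' h g' g
    using is_functorD(6)[OF F(4), of "(h', h)" "(g', g)"] that
    by (simp add: composable_cat_def composable_iff)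
  show ?thesis
    unfolding structure_maps_functorial_def
  proof (intro conjI)
    show "is_functor B A (src P) (src Q)"
      by (rule is_functorI) (use eq C S T U M1 in \<open>auto simp: composable_iff\<close>)
    show "is_functor B A (tgt P) (tgt Q)"
      by (rule is_functorI) (use eq C S T U M2 in \<open>auto simp: composable_iff\<close>)
    show "is_functor A B (unt P) (unt Q)"
      by (rule is_functorI) (use eq C S T U M3 in \<open>auto simp: composable_iff\<close>)
    show "is_functor (composable_cat P Q B) B (\<lambda>(g', g). prd P g' g) (\<lambda>(g', g). prd Q g' g)"
    proof (rule is_functorI, goal_cases)
      case (1 x) then show ?case using C eq by (cases x) (auto simp: composable_cat_def)
    next
      case (2 x) then show ?case using C eq by (cases x) (auto simp: composable_cat_def)
    next
      case (3 g) then show ?case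
        using S(6) eq by (cases g) (auto simp: composable_cat_def composable_iff)
    next
      case (4 g) then show ?case
        using T(6) eq by (cases g) (auto simp: composable_cat_def composable_iff)
    next
      case (5 x) then show ?case
        using U(6) eq by (cases x) (auto simp: composable_cat_def composable_iff)
    next
      case (6 h g)
      obtain h' h0 g' g0 where "h = (h', h0)" "g = (g', g0)" by (cases h, cases g)
      with 6 show ?case
        using M4[of h' g' h0 g0] eq by (auto simp: composable_cat_def composable_iff)
    qed
  qed
qed

text \<open>By the symmetry just shown it is enough to treat the structure maps of one direction;
  for derived faces this is the direction whose product is easier to handle.\<close>

lemma double_categoryI:
  assumes "small_category A" "small_category B" "small_category P" "small_category Q"
    "Obj A = Obj P" "Mor A = Obj Q" "Obj B = Mor P" "Mor B = Mor Q"
    "structure_maps_functorial A B P Q"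
  shows "double_category A B P Q"
  using assms structure_maps_functorial_sym[OF assms] by (simp add: double_category_def)

lemma double_category_sym: "double_category A B P Q \<Longrightarrow> double_category P Q A B"
  by (auto simp: double_category_def)

section \<open>Derived categories and functors\<close>

definition dcat :: "'k ring \<Rightarrow> bool \<Rightarrow> bool \<Rightarrow> ('k, ('v, 'k) tup) module \<Rightarrow> ('k, ('v, 'k) tup) module
    \<Rightarrow> (('v, 'k) tup, ('v, 'k) tup) small_cat \<Rightarrow> (('v, 'k) tup, ('v, 'k) tup) small_cat" where
  "dcat K a b = derived_cat (dset K a b) (dmap id K a b) (regroup a)"

lemma dcat_simps [simp]:
  "Obj (dcat K a b Eo Em C) = dset K a b Eo (Obj C)"
  "Mor (dcat K a b Eo Em C) = dset K a b Em (Mor C)"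
  "src (dcat K a b Eo Em C) = dmap id K a b Em Eo (src C)"
  "tgt (dcat K a b Eo Em C) = dmap id K a b Em Eo (tgt C)"
  "unt (dcat K a b Eo Em C) = dmap id K a b Eo Em (unt C)"
  "prd (dcat K a b Eo Em C) g' g =
     dmap id K a b (Em \<times>\<^sub>m Em) Em (\<lambda>p. prd C (tfst p) (tsnd p)) (regroup a g' g)"
  by (simp_all add: dcat_def derived_cat_def)

text \<open>The closure conditions alone. They suffice on the domain of a functor that is to be
  derived, and they spare a proof of the category axioms for the category of composable
  pairs.\<close>

definition well_typed :: "('o, 'm) small_cat \<Rightarrow> bool" where
  "well_typed C \<longleftrightarrow> src C \<in> Mor C \<rightarrow> Obj C \<and> tgt C \<in> Mor C \<rightarrow> Obj C \<and> unt C \<in> Obj C \<rightarrow> Mor C \<and>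
     (\<forall>(g', g)\<in>composable C. prd C g' g \<in> Mor C)"

lemma small_category_well_typed: "small_category C \<Longrightarrow> well_typed C"
  by (auto simp: small_category_def well_typed_def)

abbreviation composables :: "(('v, 'k) tup, ('v, 'k) tup) small_cat \<Rightarrow> ('v, 'k) tup set" where
  "composables C \<equiv> pullback (Mor C) (Mor C) (src C) (tgt C)"

lemma composables_iff [simp]: "(g' \<^bold>, g) \<in> composables C \<longleftrightarrow> (g', g) \<in> composable C"
  by (auto simp: pullback_def composable_def)

lemma composables_tfst_tsnd:
  "z \<in> composables C \<Longrightarrow> (tfst z, tsnd z) \<in> composable C \<and> (tfst z \<^bold>, tsnd z) = z"
  by (auto simp: pullback_def composable_def)

lemma linear_set_pullback:
  "linear_set K Y' E' \<Longrightarrow> linear_set K Y E \<Longrightarrow> linear_set K (pullback Y' Y g f) (E' \<times>\<^sub>m E)"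
  by (erule linear_set_prod) (auto simp: pullback_def)

context unital_scalars
begin

text \<open>Composability in the derived category says that the derived target of p equals the
  derived source of p', which is the hypothesis of \<open>regroup_pullback\<close> for the pair of
  maps source, target.\<close>

lemma composable_dcat:
  assumes "linear_set K (Obj C) Eo" "linear_set K (Mor C) Em" "well_typed C"
    and "(p', p) \<in> composable (dcat K a b Eo Em C)"
  shows "regroup a p' p \<in> dset K a b (Em \<times>\<^sub>m Em) (composables C)"
    and "dmap id K a b (Em \<times>\<^sub>m Em) Em tfst (regroup a p' p) = p'"
    and "dmap id K a b (Em \<times>\<^sub>m Em) Em tsnd (regroup a p' p) = p"
  using regroup_pullback[OF assms(2,2,1), of "src C" "tgt C" p' a b p] assms(3,4)
  by (auto simp: well_typed_def composable_iff)

text \<open>The other half of the bijection: by \<open>regroup_dmap\<close> the regrouped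
  projections form the derived map of the identity.\<close>

lemma regroup_projections:
  assumes "linear_set K Y' E'" "linear_set K Y E" "s \<in> dset K a b (E' \<times>\<^sub>m E) (pullback Y' Y g f)"
  shows "regroup a (dmap id K a b (E' \<times>\<^sub>m E) E' tfst s) (dmap id K a b (E' \<times>\<^sub>m E) E tsnd s) = s"
proof -
  note L = linear_set_pullback[OF assms(1,2), of g f]
  have "regroup a (dmap id K a b (E' \<times>\<^sub>m E) E' tfst s) (dmap id K a b (E' \<times>\<^sub>m E) E tsnd s)
      = dmap id K a b (E' \<times>\<^sub>m E) (E' \<times>\<^sub>m E) (\<lambda>x. tfst x \<^bold>, tsnd x) s"
    by (rule regroup_dmap[OF L assms(1,2) _ _ assms(3)]) (auto simp: pullback_def)
  also have "\<dots> = s"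
    by (rule dmap_ident[OF L assms(3)]) (auto simp: pullback_def)
  finally show ?thesis .
qed

text \<open>The axioms are equations between maps on objects, arrows, composable pairs or composable
  triples. Each side is rewritten as a single derived map by \<open>dmap_comp\<close> and
  \<open>regroup_dmap\<close>; then the underlying maps are compared pointwise by
  \<open>dmap_cong\<close> or \<open>dmap_ident\<close>.\<close>

lemma small_category_dcat:
  assumes C: "small_category C" and Lo: "linear_set K (Obj C) Eo" and Lm: "linear_set K (Mor C) Em"
  shows "small_category (dcat K a b Eo Em C)"
proof -
  note wt = small_category_well_typed[OF C]
  note [simp] = small_categoryD[OF C]
  let ?T = "dmap id K a b" and ?E = "Em \<times>\<^sub>m Em" and ?P = "composables C" and ?D = "dcat K a b Eo Em C"
  let ?m = "\<lambda>p. prd C (tfst p) (tsnd p)"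
  note Lp = linear_set_pullback[OF Lm Lm, of "src C" "tgt C"]
  note comp_m = dmap_comp[OF Lm Lo, where u = id and w = id and z = id]
  note comp_o = dmap_comp[OF Lo Lm, where u = id and w = id and z = id]
  note comp_p = dmap_comp[OF Lp Lm, where u = id and w = id and z = id]
  have m: "?m \<in> ?P \<rightarrow> Mor C" and f: "tfst \<in> ?P \<rightarrow> Mor C" and s: "tsnd \<in> ?P \<rightarrow> Mor C"
    by (auto simp: pullback_def composable_iff)
  note q = composable_dcat[OF Lo Lm wt]
  have unit_laws: "prd ?D g (unt ?D (src ?D g)) = g" "prd ?D (unt ?D (tgt ?D g)) g = g"
    if g: "g \<in> dset K a b Em (Mor C)" for g
  proof -
    have g0: "?T Em Em (\<lambda>x. x) g = g" by (rule dmap_ident[OF Lm g]) simp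
    have us: "?T Eo Em (unt C) (?T Em Eo (src C) g) = ?T Em Em (\<lambda>x. unt C (src C x)) g"
      by (rule comp_m[OF _ g]) auto
    have ut: "?T Eo Em (unt C) (?T Em Eo (tgt C) g) = ?T Em Em (\<lambda>x. unt C (tgt C x)) g"
      by (rule comp_m[OF _ g]) auto
    \<comment> \<open>Since g is the derived identity at g, the pair of g and its unit is the image
      of g under the map derived from x |-> (x, unit of the source of x).\<close>
    have "regroup a g (?T Eo Em (unt C) (?T Em Eo (src C) g))
        = ?T Em ?E (\<lambda>x. x \<^bold>, unt C (src C x)) g"
      using regroup_dmap[OF Lm Lm Lm _ _ g, of "\<lambda>x. x" "\<lambda>x. unt C (src C x)" id] g0 us by simp
    moreover have "?T ?E Em ?m (?T Em ?E (\<lambda>x. x \<^bold>, unt C (src C x)) g)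
        = ?T Em Em (\<lambda>x. ?m (x \<^bold>, unt C (src C x))) g"
      by (rule dmap_comp[OF Lm Lp _ g]) (auto simp: composable_iff)
    moreover have "\<dots> = g" by (rule dmap_ident[OF Lm g]) simp
    ultimately show "prd ?D g (unt ?D (src ?D g)) = g" by simp
    have "regroup a (?T Eo Em (unt C) (?T Em Eo (tgt C) g)) g
        = ?T Em ?E (\<lambda>x. unt C (tgt C x) \<^bold>, x) g"
      using regroup_dmap[OF Lm Lm Lm _ _ g, of "\<lambda>x. unt C (tgt C x)" "\<lambda>x. x" id] g0 ut by simp
    moreover have "?T ?E Em ?m (?T Em ?E (\<lambda>x. unt C (tgt C x) \<^bold>, x) g)
        = ?T Em Em (\<lambda>x. ?m (unt C (tgt C x) \<^bold>, x)) g"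
      by (rule dmap_comp[OF Lm Lp _ g]) (auto simp: composable_iff)
    moreover have "\<dots> = g" by (rule dmap_ident[OF Lm g]) simp
    ultimately show "prd ?D (unt ?D (tgt ?D g)) g = g" by simp
  qed
  have ends: "src ?D (prd ?D p' p) = src ?D p" "tgt ?D (prd ?D p' p) = tgt ?D p'"
    if pp: "(p', p) \<in> composable ?D" for p' p
  proof -
    note q = q[OF pp]
    let ?q = "regroup a p' p"
    have "?T Em Eo (src C) (?T ?E Em ?m ?q) = ?T ?E Eo (\<lambda>z. src C (?m z)) ?q"
      by (rule comp_p[OF m q(1)])
    also have "\<dots> = ?T ?E Eo (\<lambda>z. src C (tsnd z)) ?q"
      by (rule dmap_cong[OF q(1)]) (auto dest: composables_tfst_tsnd)
    also have "\<dots> = ?T Em Eo (src C) (?T ?E Em tsnd ?q)"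
      by (rule comp_p[OF s q(1), symmetric])
    finally show "src ?D (prd ?D p' p) = src ?D p" by (simp add: q)
    have "?T Em Eo (tgt C) (?T ?E Em ?m ?q) = ?T ?E Eo (\<lambda>z. tgt C (?m z)) ?q"
      by (rule comp_p[OF m q(1)])
    also have "\<dots> = ?T ?E Eo (\<lambda>z. tgt C (tfst z)) ?q"
      by (rule dmap_cong[OF q(1)]) (auto dest: composables_tfst_tsnd)
    also have "\<dots> = ?T Em Eo (tgt C) (?T ?E Em tfst ?q)"
      by (rule comp_p[OF f q(1), symmetric])
    finally show "tgt ?D (prd ?D p' p) = tgt ?D p'" by (simp add: q)
  qed
  have assoc: "prd ?D p'' (prd ?D p' p) = prd ?D (prd ?D p'' p') p"
    if pp: "(p'', p') \<in> composable ?D" "(p', p) \<in> composable ?D" for p'' p' p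
  proof -
    note q2 = q[OF pp(1)] and q1 = q[OF pp(2)]
    let ?q2 = "regroup a p'' p'" and ?q1 = "regroup a p' p"
    \<comment> \<open>A composable triple is a pair of composable pairs with a common middle arrow,
      a fibre product over \<open>Mor C\<close>. Here the common middle arrow is p', and ?r is the
      triple as one increment of that set.\<close>
    let ?r = "regroup a ?q2 ?q1" and ?PP = "pullback ?P ?P tsnd tfst"
    note r = regroup_pullback[OF Lp Lp Lm s f q2(1) q1(1), unfolded q2 q1, OF refl]
    note Lr = linear_set_pullback[OF Lp Lp, of tsnd tfst]
    note comp_r = dmap_comp[OF Lr Lp, where u = id and w = id and z = id]
    have ff: "tfst \<in> ?PP \<rightarrow> ?P" and ss: "tsnd \<in> ?PP \<rightarrow> ?P"
      by (auto simp: pullback_def)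
    have PP: "\<exists>g'' g' g. z = ((g'' \<^bold>, g') \<^bold>, (g' \<^bold>, g)) \<and> (g'', g') \<in> composable C
        \<and> (g', g) \<in> composable C" if "z \<in> ?PP" for z
      using that by (auto simp: pullback_def composable_iff)
    have e1: "p'' = ?T (?E \<times>\<^sub>m ?E) Em (\<lambda>z. tfst (tfst z)) ?r"
      using comp_r[OF ff r(1), of Em tfst] by (simp add: r q2)
    have e2: "?T ?E Em ?m ?q1 = ?T (?E \<times>\<^sub>m ?E) Em (\<lambda>z. ?m (tsnd z)) ?r"
      using comp_r[OF ss r(1), of Em ?m] by (simp add: r)
    have e3: "p = ?T (?E \<times>\<^sub>m ?E) Em (\<lambda>z. tsnd (tsnd z)) ?r"
      using comp_r[OF ss r(1), of Em tsnd] by (simp add: r q1)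
    have e4: "?T ?E Em ?m ?q2 = ?T (?E \<times>\<^sub>m ?E) Em (\<lambda>z. ?m (tfst z)) ?r"
      using comp_r[OF ff r(1), of Em ?m] by (simp add: r)
    have "regroup a p'' (?T ?E Em ?m ?q1)
        = ?T (?E \<times>\<^sub>m ?E) ?E (\<lambda>z. tfst (tfst z) \<^bold>, ?m (tsnd z)) ?r"
      unfolding e2 by (subst e1, rule regroup_dmap[OF Lr Lm Lm _ _ r(1)])
         (auto dest!: PP simp: composable_iff)
    moreover have "?T ?E Em ?m (?T (?E \<times>\<^sub>m ?E) ?E (\<lambda>z. tfst (tfst z) \<^bold>, ?m (tsnd z)) ?r)
        = ?T (?E \<times>\<^sub>m ?E) Em (\<lambda>z. ?m (tfst (tfst z) \<^bold>, ?m (tsnd z))) ?r"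
      by (rule comp_r[OF _ r(1)]) (auto dest!: PP simp: composable_iff)
    \<comment> \<open>Both bracketings are now derived maps evaluated at ?r, and associativity of C
      applies pointwise to the underlying maps.\<close>
    moreover have "\<dots> = ?T (?E \<times>\<^sub>m ?E) Em (\<lambda>z. ?m (?m (tfst z) \<^bold>, tsnd (tsnd z))) ?r"
      by (rule dmap_cong[OF r(1)]) (auto dest!: PP)
    moreover have "?T ?E Em ?m (?T (?E \<times>\<^sub>m ?E) ?E (\<lambda>z. ?m (tfst z) \<^bold>, tsnd (tsnd z)) ?r) = \<dots>"
      by (rule comp_r[OF _ r(1)]) (auto dest!: PP simp: composable_iff)
    moreover have "regroup a (?T ?E Em ?m ?q2) p
        = ?T (?E \<times>\<^sub>m ?E) ?E (\<lambda>z. ?m (tfst z) \<^bold>, tsnd (tsnd z)) ?r"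
      unfolding e4 by (subst e3, rule regroup_dmap[OF Lr Lm Lm _ _ r(1)])
         (auto dest!: PP simp: composable_iff)
    ultimately show ?thesis by simp
  qed
  have units: "src ?D (unt ?D x) = x" "tgt ?D (unt ?D x) = x" if x: "x \<in> dset K a b Eo (Obj C)" for x
  proof -
    have "?T Em Eo (src C) (?T Eo Em (unt C) x) = ?T Eo Eo (\<lambda>x. src C (unt C x)) x"
      by (rule comp_o[OF _ x]) auto
    moreover have "\<dots> = x" by (rule dmap_ident[OF Lo x]) simp
    ultimately show "src ?D (unt ?D x) = x" by simp
    have "?T Em Eo (tgt C) (?T Eo Em (unt C) x) = ?T Eo Eo (\<lambda>x. tgt C (unt C x)) x"
      by (rule comp_o[OF _ x]) auto
    moreover have "\<dots> = x" by (rule dmap_ident[OF Lo x]) simp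
    ultimately show "tgt ?D (unt ?D x) = x" by simp
  qed
  have typing: "src ?D \<in> Mor ?D \<rightarrow> Obj ?D" "tgt ?D \<in> Mor ?D \<rightarrow> Obj ?D" "unt ?D \<in> Obj ?D \<rightarrow> Mor ?D"
    by (auto intro!: dmap_in[OF Lm Lo] dmap_in[OF Lo Lm])
  have "prd ?D p' p \<in> Mor ?D" if "(p', p) \<in> composable ?D" for p' p
    using dmap_in[OF Lp Lm m q(1)[OF that]] by simp
  then show ?thesis
    unfolding small_category_def using typing units ends assoc unit_laws by auto
qed

text \<open>Each functor equation equates two composite maps, and derivation respects composition.
  For products the pair map (Fm, Fm) on composable pairs is derived too. The target may have another
  vector type, so the lemma applies both to structure maps and to maps coming from f.\<close>

lemma is_functor_dcat:
  fixes C :: "(('v, 'k) tup, ('v, 'k) tup) small_cat" and D :: "(('w, 'k) tup, ('w, 'k) tup) small_cat"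
  assumes F: "is_functor C D Fo Fm" and wt: "well_typed C"
    and Lo: "linear_set K (Obj C) Eo" and Lm: "linear_set K (Mor C) Em"
    and Lo': "linear_set K (Obj D) Eo'" and Lm': "linear_set K (Mor D) Em'"
  shows "is_functor (dcat K a b Eo Em C) (dcat K a b Eo' Em' D)
    (dmap u K a b Eo Eo' Fo) (dmap u K a b Em Em' Fm)"
proof -
  note [simp] = is_functorD[OF F]
  have [simp]: "\<And>g. g \<in> Mor C \<Longrightarrow> src C g \<in> Obj C" "\<And>g. g \<in> Mor C \<Longrightarrow> tgt C g \<in> Obj C"
    "\<And>x. x \<in> Obj C \<Longrightarrow> unt C x \<in> Mor C" "\<And>g' g. (g', g) \<in> composable C \<Longrightarrow> prd C g' g \<in> Mor C"
    using wt by (auto simp: well_typed_def)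
  let ?T = "dmap id K a b" and ?E = "Em \<times>\<^sub>m Em" and ?P = "composables C" and ?m = "\<lambda>p. prd C (tfst p) (tsnd p)"
  let ?m' = "\<lambda>p. prd D (tfst p) (tsnd p)" and ?F = "dmap u K a b"
  note Lp = linear_set_pullback[OF Lm Lm, of "src C" "tgt C"]
  note Lp' = linear_set_pullback[OF Lm' Lm', of "src D" "tgt D"]
  have f: "tfst \<in> ?P \<rightarrow> Mor C" and s: "tsnd \<in> ?P \<rightarrow> Mor C"
    by (auto simp: pullback_def)
  have Fo: "Fo \<in> Obj C \<rightarrow> Obj D" and Fm: "Fm \<in> Mor C \<rightarrow> Mor D" by auto
  show ?thesis
  proof (rule is_functorI)
    fix g assume "g \<in> Mor (dcat K a b Eo Em C)"
    then have g: "g \<in> dset K a b Em (Mor C)" by simp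
    show "?F Em Em' Fm g \<in> Mor (dcat K a b Eo' Em' D)"
      using dmap_in[OF Lm Lm' Fm g] by simp
    have "?T Em' Eo' (src D) (?F Em Em' Fm g) = ?F Em Eo' (\<lambda>x. src D (Fm x)) g"
      by (rule dmap_comp[OF Lm Lm' Fm g])
    also have "\<dots> = ?F Em Eo' (\<lambda>x. Fo (src C x)) g"
      by (rule dmap_cong[OF g]) simp
    also have "\<dots> = ?F Eo Eo' Fo (?T Em Eo (src C) g)"
      by (rule dmap_comp[OF Lm Lo _ g, symmetric]) simp
    finally show "src (dcat K a b Eo' Em' D) (?F Em Em' Fm g) = ?F Eo Eo' Fo (src (dcat K a b Eo Em C) g)"
      by simp
    have "?T Em' Eo' (tgt D) (?F Em Em' Fm g) = ?F Em Eo' (\<lambda>x. tgt D (Fm x)) g"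
      by (rule dmap_comp[OF Lm Lm' Fm g])
    also have "\<dots> = ?F Em Eo' (\<lambda>x. Fo (tgt C x)) g"
      by (rule dmap_cong[OF g]) simp
    also have "\<dots> = ?F Eo Eo' Fo (?T Em Eo (tgt C) g)"
      by (rule dmap_comp[OF Lm Lo _ g, symmetric]) simp
    finally show "tgt (dcat K a b Eo' Em' D) (?F Em Em' Fm g) = ?F Eo Eo' Fo (tgt (dcat K a b Eo Em C) g)"
      by simp
  next
    fix x assume "x \<in> Obj (dcat K a b Eo Em C)"
    then have x: "x \<in> dset K a b Eo (Obj C)" by simp
    show "?F Eo Eo' Fo x \<in> Obj (dcat K a b Eo' Em' D)"
      using dmap_in[OF Lo Lo' Fo x] by simp
    have "?F Em Em' Fm (?T Eo Em (unt C) x) = ?F Eo Em' (\<lambda>x. Fm (unt C x)) x"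
      by (rule dmap_comp[OF Lo Lm _ x]) simp
    also have "\<dots> = ?F Eo Em' (\<lambda>x. unt D (Fo x)) x"
      by (rule dmap_cong[OF x]) simp
    also have "\<dots> = ?T Eo' Em' (unt D) (?F Eo Eo' Fo x)"
      by (rule dmap_comp[OF Lo Lo' Fo x, symmetric])
    finally show "?F Em Em' Fm (unt (dcat K a b Eo Em C) x) = unt (dcat K a b Eo' Em' D) (?F Eo Eo' Fo x)"
      by simp
  next
    fix p' p assume pp: "(p', p) \<in> composable (dcat K a b Eo Em C)"
    note q = composable_dcat[OF Lo Lm wt pp]
    let ?q = "regroup a p' p" and ?G = "\<lambda>z. Fm (tfst z) \<^bold>, Fm (tsnd z)"
    have "?F Em Em' Fm p' = ?F ?E Em' (\<lambda>z. Fm (tfst z)) ?q"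
      using dmap_comp[OF Lp Lm f q(1), where u = id and w = u and z = u and g = Fm] by (simp add: q)
    moreover have "?F Em Em' Fm p = ?F ?E Em' (\<lambda>z. Fm (tsnd z)) ?q"
      using dmap_comp[OF Lp Lm s q(1), where u = id and w = u and z = u and g = Fm] by (simp add: q)
    moreover have "regroup a (?F ?E Em' (\<lambda>z. Fm (tfst z)) ?q) (?F ?E Em' (\<lambda>z. Fm (tsnd z)) ?q)
        = ?F ?E (Em' \<times>\<^sub>m Em') ?G ?q"
      by (rule regroup_dmap[OF Lp Lm' Lm' _ _ q(1)]) (auto simp: pullback_def)
    moreover have "?T (Em' \<times>\<^sub>m Em') Em' ?m' (?F ?E (Em' \<times>\<^sub>m Em') ?G ?q) = ?F ?E Em' (\<lambda>z. ?m' (?G z)) ?q"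
      by (rule dmap_comp[OF Lp Lp' _ q(1)]) (auto simp: pullback_def)
    moreover have "\<dots> = ?F ?E Em' (\<lambda>z. Fm (?m z)) ?q"
      by (rule dmap_cong[OF q(1)]) (auto dest: composables_tfst_tsnd)
    moreover have "\<dots> = ?F Em Em' Fm (?T ?E Em ?m ?q)"
      by (rule dmap_comp[OF Lp Lm _ q(1), symmetric]) (auto dest: composables_tfst_tsnd)
    ultimately show "?F Em Em' Fm (prd (dcat K a b Eo Em C) p' p)
        = prd (dcat K a b Eo' Em' D) (?F Em Em' Fm p') (?F Em Em' Fm p)"
      by simp
  qed
qed

end

text \<open>\<^const>\<open>composable_cat\<close> with pairs encoded in \<^typ>\<open>('v, 'k) tup\<close>, so that it can be derived.\<close>

definition composables_cat ::
  "(('v, 'k) tup, ('v, 'k) tup) small_cat \<Rightarrow> (('v, 'k) tup, ('v, 'k) tup) small_cat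
    \<Rightarrow> (('v, 'k) tup, ('v, 'k) tup) small_cat \<Rightarrow> (('v, 'k) tup, ('v, 'k) tup) small_cat" where
  "composables_cat A B Q =
     \<lparr>Obj = composables A, Mor = composables B,
      src = (\<lambda>z. src Q (tfst z) \<^bold>, src Q (tsnd z)), tgt = (\<lambda>z. tgt Q (tfst z) \<^bold>, tgt Q (tsnd z)),
      unt = (\<lambda>z. unt Q (tfst z) \<^bold>, unt Q (tsnd z)),
      prd = (\<lambda>z' z. prd Q (tfst z') (tfst z) \<^bold>, prd Q (tsnd z') (tsnd z))\<rparr>"

lemma is_functor_composables_cat:
  assumes "is_functor (composable_cat A B Q) Q (\<lambda>(g', g). prd A g' g) (\<lambda>(g', g). prd B g' g)"
  shows "is_functor (composables_cat A B Q) Q (\<lambda>z. prd A (tfst z) (tsnd z)) (\<lambda>z. prd B (tfst z) (tsnd z))"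
proof -
  note F = is_functorD[OF assms]
  show ?thesis
  proof (rule is_functorI, goal_cases)
    case (1 x)
    then show ?case using F(1)[of "(tfst x, tsnd x)"]
      by (auto simp: composables_cat_def composable_cat_def dest: composables_tfst_tsnd)
  next
    case (2 x)
    then show ?case using F(2)[of "(tfst x, tsnd x)"]
      by (auto simp: composables_cat_def composable_cat_def dest: composables_tfst_tsnd)
  next
    case (3 x)
    then show ?case using F(3)[of "(tfst x, tsnd x)"]
      by (auto simp: composables_cat_def composable_cat_def dest: composables_tfst_tsnd)
  next
    case (4 x)
    then show ?case using F(4)[of "(tfst x, tsnd x)"]
      by (auto simp: composables_cat_def composable_cat_def dest: composables_tfst_tsnd)
  next
    case (5 x)
    then show ?case using F(5)[of "(tfst x, tsnd x)"]
      by (auto simp: composables_cat_def composable_cat_def dest: composables_tfst_tsnd)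
  next
    case (6 x y)
    then have "(tfst x, tsnd x) \<in> composable B" "(tfst y, tsnd y) \<in> composable B"
      by (auto simp: composables_cat_def composable_iff dest: composables_tfst_tsnd)
    with 6 show ?case using F(6)[of "(tfst x, tsnd x)" "(tfst y, tsnd y)"]
      by (simp add: composables_cat_def composable_cat_def composable_iff)
  qed
qed

text \<open>Source and target of one direction commute with source, target, unit and product of the
  other, so applying these componentwise takes composable pairs to composable pairs.\<close>

lemma well_typed_composables_cat:
  assumes "small_category Q" "Mor A = Obj Q" "Mor B = Mor Q"
    and "is_functor Q P (src A) (src B)" "is_functor Q P (tgt A) (tgt B)" "is_functor P Q (unt A) (unt B)"
    and "well_typed A"
  shows "well_typed (composables_cat A B Q)"
proof -
  note C = small_categoryD[OF assms(1)]
  note S = is_functorD[OF assms(4)] and T = is_functorD[OF assms(5)] and U = is_functorD[OF assms(6)]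
  have "src (composables_cat A B Q) z \<in> composables A" "tgt (composables_cat A B Q) z \<in> composables A"
    if zin: "z \<in> composables B" for z
  proof -
    obtain g' g where z: "z = (g' \<^bold>, g)" "g' \<in> Mor Q" "g \<in> Mor Q" "tgt B g = src B g'"
      using zin unfolding pullback_def assms(3) by blast
    have "tgt A (src Q g) = src A (src Q g')" "tgt A (tgt Q g) = src A (tgt Q g')"
      using z(4) S(3,4)[OF z(2)] T(3,4)[OF z(3)] by simp_all
    then show "src (composables_cat A B Q) z \<in> composables A" "tgt (composables_cat A B Q) z \<in> composables A"
      using z C(1,2)[OF z(2)] C(1,2)[OF z(3)] assms(2)
      by (simp_all add: composables_cat_def pullback_iff)
  qed
  moreover have "unt (composables_cat A B Q) z \<in> composables B" if zin: "z \<in> composables A" for z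
  proof -
    obtain x' x where z: "z = (x' \<^bold>, x)" "x' \<in> Obj Q" "x \<in> Obj Q" "tgt A x = src A x'"
      using zin unfolding pullback_def assms(2) by blast
    then show ?thesis
      using S(5)[OF z(2)] T(5)[OF z(3)] C(3)[OF z(2)] C(3)[OF z(3)] assms(3)
      by (simp add: composables_cat_def pullback_iff)
  qed
  moreover have "prd (composables_cat A B Q) z' z \<in> composables B"
    if "(z', z) \<in> composable (composables_cat A B Q)" for z' z
  proof -
    have z: "(tfst z', tsnd z') \<in> composable B" "(tfst z, tsnd z) \<in> composable B"
      "(tfst z', tfst z) \<in> composable Q" "(tsnd z', tsnd z) \<in> composable Q"
      using that composables_tfst_tsnd[of z' B] composables_tfst_tsnd[of z B]
      by (simp_all add: composables_cat_def composable_iff assms(3)[symmetric])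
    have "tgt B (prd Q (tsnd z') (tsnd z)) = src B (prd Q (tfst z') (tfst z))"
      using z S(6)[OF z(3)] T(6)[OF z(4)] by (auto simp: composable_iff)
    then show ?thesis
      using C(6)[OF z(3)] C(6)[OF z(4)] assms(3) by (simp add: composables_cat_def pullback_iff)
  qed
  moreover have "Obj (composables_cat A B Q) = composables A" "Mor (composables_cat A B Q) = composables B"
    by (simp_all add: composables_cat_def)
  ultimately show ?thesis
    by (auto simp only: well_typed_def Pi_iff)
qed

context unital_scalars
begin

text \<open>Deriving the product functor of a face yields a functor on the derived category of
  composable pairs, but the derived face needs one on the composable pairs of the derived
  categories. Regrouping passes from the latter to the former.\<close>

lemma is_functor_regroup:
  assumes Q: "small_category Q" and A: "small_category A" and B: "small_category B"
    and eq: "Mor A = Obj Q" "Mor B = Mor Q"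
    and F: "is_functor Q P (src A) (src B)" "is_functor Q P (tgt A) (tgt B)" "is_functor P Q (unt A) (unt B)"
    and L: "linear_set K (Obj A) E0" "linear_set K (Mor A) E1" "linear_set K (Obj B) E2"
      "linear_set K (Mor B) E12"
  shows "is_functor (composable_cat (dcat K a b E0 E1 A) (dcat K a b E2 E12 B) (dcat K a b E1 E12 Q))
    (dcat K a b (E1 \<times>\<^sub>m E1) (E12 \<times>\<^sub>m E12) (composables_cat A B Q))
    (\<lambda>(p', p). regroup a p' p) (\<lambda>(p', p). regroup a p' p)"
proof -
  note wtA = small_category_well_typed[OF A] and wtB = small_category_well_typed[OF B]
  note wt = well_typed_composables_cat[OF Q eq F wtA]
  let ?C = "composables_cat A B Q" and ?T = "dmap id K a b"
  let ?A = "dcat K a b E0 E1 A" and ?B = "dcat K a b E2 E12 B" and ?Q = "dcat K a b E1 E12 Q"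
  let ?D = "dcat K a b (E1 \<times>\<^sub>m E1) (E12 \<times>\<^sub>m E12) ?C" and ?E1 = "E1 \<times>\<^sub>m E1" and ?E12 = "E12 \<times>\<^sub>m E12"
  have qA: "regroup a p' p \<in> dset K a b ?E1 (composables A)"
    "?T ?E1 E1 tfst (regroup a p' p) = p'" "?T ?E1 E1 tsnd (regroup a p' p) = p"
    if "(p', p) \<in> composable ?A" for p' p
    using composable_dcat[OF L(1,2) wtA that] by auto
  have qB: "regroup a p' p \<in> dset K a b ?E12 (composables B)"
    "?T ?E12 E12 tfst (regroup a p' p) = p'" "?T ?E12 E12 tsnd (regroup a p' p) = p"
    if "(p', p) \<in> composable ?B" for p' p
    using composable_dcat[OF L(3,4) wtB that] by auto
  note LA = linear_set_pullback[OF L(2,2), of "src A" "tgt A"]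
  note LB = linear_set_pullback[OF L(4,4), of "src B" "tgt B"]
  have LQo: "linear_set K (Obj Q) E1" and LQm: "linear_set K (Mor Q) E12"
    using L eq by auto
  note LQ = linear_set_pullback[OF LQm LQm, of "src Q" "tgt Q"]
  have pr: "tfst \<in> composables A \<rightarrow> Obj Q" "tsnd \<in> composables A \<rightarrow> Obj Q"
    "tfst \<in> composables B \<rightarrow> Mor Q" "tsnd \<in> composables B \<rightarrow> Mor Q"
    using eq by (auto simp: pullback_def)
  \<comment> \<open>A structure map applied to both components commutes with regrouping, because
    both components are projections of one increment.\<close>
  have str: "?T ?E12 ?E1 (\<lambda>z. f (tfst z) \<^bold>, f (tsnd z)) (regroup a p' p)
      = regroup a (?T E12 E1 f p') (?T E12 E1 f p)"
    if pp: "(p', p) \<in> composable ?B" and f: "f \<in> Mor Q \<rightarrow> Obj Q" for f p' p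
  proof -
    note q = qB[OF pp]
    have "?T E12 E1 f p' = ?T ?E12 E1 (\<lambda>z. f (tfst z)) (regroup a p' p)"
      "?T E12 E1 f p = ?T ?E12 E1 (\<lambda>z. f (tsnd z)) (regroup a p' p)"
      using dmap_comp[OF LB LQm pr(3) q(1), of id E1 f id id] dmap_comp[OF LB LQm pr(4) q(1), of id E1 f id id]
      by (simp_all add: q)
    then show ?thesis
      using regroup_dmap[OF LB LQo LQo _ _ q(1), of "\<lambda>z. f (tfst z)" "\<lambda>z. f (tsnd z)" id] f pr(3,4)
      by (simp add: Pi_iff)
  qed
  have srcQ: "src Q \<in> Mor Q \<rightarrow> Obj Q" and tgtQ: "tgt Q \<in> Mor Q \<rightarrow> Obj Q" and untQ: "unt Q \<in> Obj Q \<rightarrow> Mor Q"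
    using small_categoryD[OF Q] by auto
  show ?thesis
  proof (rule is_functorI, goal_cases)
    case (1 x)
    then show ?case using qA(1) by (cases x) (auto simp: composable_cat_def composables_cat_def)
  next
    case (2 x)
    then show ?case using qB(1) by (cases x) (auto simp: composable_cat_def composables_cat_def)
  next
    case (3 x)
    then show ?case using str[OF _ srcQ] by (cases x) (auto simp: composable_cat_def composables_cat_def)
  next
    case (4 x)
    then show ?case using str[OF _ tgtQ] by (cases x) (auto simp: composable_cat_def composables_cat_def)
  next
    case (5 x)
    then obtain p' p where x: "x = (p', p)" and pp: "(p', p) \<in> composable ?A"
      by (cases x) (auto simp: composable_cat_def)
    note q = qA[OF pp]
    have "?T E1 E12 (unt Q) p' = ?T ?E1 E12 (\<lambda>z. unt Q (tfst z)) (regroup a p' p)"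
      "?T E1 E12 (unt Q) p = ?T ?E1 E12 (\<lambda>z. unt Q (tsnd z)) (regroup a p' p)"
      using dmap_comp[OF LA LQo pr(1) q(1), of id E12 "unt Q" id id]
        dmap_comp[OF LA LQo pr(2) q(1), of id E12 "unt Q" id id]
      by (simp_all add: q)
    then have "regroup a (?T E1 E12 (unt Q) p') (?T E1 E12 (unt Q) p)
        = ?T ?E1 ?E12 (\<lambda>z. unt Q (tfst z) \<^bold>, unt Q (tsnd z)) (regroup a p' p)"
      using regroup_dmap[OF LA LQm LQm _ _ q(1), of "\<lambda>z. unt Q (tfst z)" "\<lambda>z. unt Q (tsnd z)" id] untQ pr(1,2)
      by (simp add: Pi_iff)
    then show ?case by (simp add: x composable_cat_def composables_cat_def)
  next
    case (6 h g)
    obtain h' h0 g' g0 where hg: "h = (h', h0)" "g = (g', g0)" by (cases h, cases g)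
    have hh: "(h', h0) \<in> composable ?B" and gg: "(g', g0) \<in> composable ?B"
      and e: "?T E12 E1 (tgt Q) g' = ?T E12 E1 (src Q) h'" "?T E12 E1 (tgt Q) g0 = ?T E12 E1 (src Q) h0"
      using 6 by (auto simp: hg composable_iff composable_cat_def)
    note h = qB[OF hh] and g = qB[OF gg]
    let ?h = "regroup a h' h0" and ?g = "regroup a g' g0"
    \<comment> \<open>A 2 x 2 array of elements, composable in both directions, is one increment ?r
      of the set of such arrays; its four entries are recovered below as derived projections of
      ?r.\<close>
    let ?r = "regroup a ?h ?g" and ?PP = "composables ?C" and ?E = "?E12 \<times>\<^sub>m ?E12"
    have "(?h, ?g) \<in> composable ?D"
      using h(1) g(1) str[OF hh srcQ] str[OF gg tgtQ] e
      by (simp add: composable_iff composables_cat_def)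
    note r0 = composable_dcat[OF _ _ wt this]
    have r: "?r \<in> dset K a b ?E ?PP" "?T ?E ?E12 tfst ?r = ?h" "?T ?E ?E12 tsnd ?r = ?g"
      using r0 LA LB by (auto simp: composables_cat_def)
    have Lr: "linear_set K ?PP ?E"
      using linear_set_pullback[OF LB LB, of "src ?C" "tgt ?C"] by (simp add: composables_cat_def)
    have PP: "\<exists>x' x y' y. z = ((x' \<^bold>, x) \<^bold>, (y' \<^bold>, y)) \<and> (x', x) \<in> composable B \<and> (y', y) \<in> composable B
        \<and> (x', y') \<in> composable Q \<and> (x, y) \<in> composable Q" if "z \<in> ?PP" for z
      using that eq by (auto simp: pullback_def composable_iff composables_cat_def)
    have ff: "tfst \<in> ?PP \<rightarrow> composables B" and ss: "tsnd \<in> ?PP \<rightarrow> composables B"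
      by (auto simp: pullback_def composables_cat_def)
    have e': "h' = ?T ?E E12 (\<lambda>z. tfst (tfst z)) ?r" "h0 = ?T ?E E12 (\<lambda>z. tsnd (tfst z)) ?r"
      "g' = ?T ?E E12 (\<lambda>z. tfst (tsnd z)) ?r" "g0 = ?T ?E E12 (\<lambda>z. tsnd (tsnd z)) ?r"
      using dmap_comp[OF Lr LB ff r(1), of id E12 tfst id id] dmap_comp[OF Lr LB ff r(1), of id E12 tsnd id id]
        dmap_comp[OF Lr LB ss r(1), of id E12 tfst id id] dmap_comp[OF Lr LB ss r(1), of id E12 tsnd id id]
      by (simp_all add: r h g)
    let ?m = "\<lambda>z. prd Q (tfst z) (tsnd z)"
    have m: "?T ?E12 E12 ?m (regroup a (?T ?E E12 u ?r) (?T ?E E12 v ?r)) = ?T ?E E12 (\<lambda>z. prd Q (u z) (v z)) ?r"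
      if uv: "\<And>z. z \<in> ?PP \<Longrightarrow> (u z, v z) \<in> composable Q" for u v
    proof -
      have "regroup a (?T ?E E12 u ?r) (?T ?E E12 v ?r) = ?T ?E ?E12 (\<lambda>z. u z \<^bold>, v z) ?r"
        by (rule regroup_dmap[OF Lr LQm LQm _ _ r(1)]) (use uv in \<open>auto simp: composable_iff\<close>)
      moreover have "?T ?E12 E12 ?m (?T ?E ?E12 (\<lambda>z. u z \<^bold>, v z) ?r) = ?T ?E E12 (\<lambda>z. ?m (u z \<^bold>, v z)) ?r"
        by (rule dmap_comp[OF Lr LQ _ r(1)]) (use uv in auto)
      ultimately show ?thesis by simp
    qed
    have "?T ?E12 E12 ?m (regroup a h' g') = ?T ?E E12 (\<lambda>z. prd Q (tfst (tfst z)) (tfst (tsnd z))) ?r"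
      by (subst e'(1), subst e'(3), rule m) (auto dest!: PP)
    moreover have "?T ?E12 E12 ?m (regroup a h0 g0) = ?T ?E E12 (\<lambda>z. prd Q (tsnd (tfst z)) (tsnd (tsnd z))) ?r"
      by (subst e'(2), subst e'(4), rule m) (auto dest!: PP)
    moreover have "regroup a (?T ?E E12 (\<lambda>z. prd Q (tfst (tfst z)) (tfst (tsnd z))) ?r)
          (?T ?E E12 (\<lambda>z. prd Q (tsnd (tfst z)) (tsnd (tsnd z))) ?r)
        = ?T ?E ?E12 (\<lambda>z. prd Q (tfst (tfst z)) (tfst (tsnd z)) \<^bold>, prd Q (tsnd (tfst z)) (tsnd (tsnd z))) ?r"
      by (rule regroup_dmap[OF Lr LQm LQm _ _ r(1)]) (auto dest!: PP simp: small_categoryD[OF Q])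
    ultimately show ?case
      by (simp add: hg composable_cat_def composables_cat_def)
  qed
qed

lemma double_category_dcat:
  assumes D: "double_category A B P Q"
    and L: "linear_set K (Obj A) E0" "linear_set K (Mor A) E1" "linear_set K (Obj B) E2"
      "linear_set K (Mor B) E12"
  shows "double_category (dcat K a b E0 E1 A) (dcat K a b E2 E12 B) (dcat K a b E0 E2 P) (dcat K a b E1 E12 Q)"
proof -
  have C: "small_category A" "small_category B" "small_category P" "small_category Q"
    and eq: "Obj A = Obj P" "Mor A = Obj Q" "Obj B = Mor P" "Mor B = Mor Q"
    and F: "is_functor Q P (src A) (src B)" "is_functor Q P (tgt A) (tgt B)" "is_functor P Q (unt A) (unt B)"
      "is_functor (composable_cat A B Q) Q (\<lambda>(g', g). prd A g' g) (\<lambda>(g', g). prd B g' g)"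
    using D by (auto simp: double_category_def structure_maps_functorial_def)
  have LP: "linear_set K (Obj P) E0" "linear_set K (Mor P) E2" and LQ: "linear_set K (Obj Q) E1" "linear_set K (Mor Q) E12"
    using L eq by auto
  note wt = small_category_well_typed
  note wtC = well_typed_composables_cat[OF C(4) eq(2,4) F(1-3) wt[OF C(1)]]
  have LC: "linear_set K (Obj (composables_cat A B Q)) (E1 \<times>\<^sub>m E1)"
    "linear_set K (Mor (composables_cat A B Q)) (E12 \<times>\<^sub>m E12)"
    using linear_set_pullback[OF L(2,2)] linear_set_pullback[OF L(4,4)] by (auto simp: composables_cat_def)
  show ?thesis
  proof (rule double_categoryI)
    show "structure_maps_functorial (dcat K a b E0 E1 A) (dcat K a b E2 E12 B)
        (dcat K a b E0 E2 P) (dcat K a b E1 E12 Q)"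
      unfolding structure_maps_functorial_def
    proof (intro conjI)
      \<comment> \<open>The derived product is regrouping followed by the map derived from the
        product, hence a composite of two functors.\<close>
      have "is_functor (composable_cat (dcat K a b E0 E1 A) (dcat K a b E2 E12 B) (dcat K a b E1 E12 Q))
          (dcat K a b E1 E12 Q)
          (\<lambda>x. dmap id K a b (E1 \<times>\<^sub>m E1) E1 (\<lambda>z. prd A (tfst z) (tsnd z)) (case x of (g', g) \<Rightarrow> regroup a g' g))
          (\<lambda>x. dmap id K a b (E12 \<times>\<^sub>m E12) E12 (\<lambda>z. prd B (tfst z) (tsnd z)) (case x of (g', g) \<Rightarrow> regroup a g' g))"
        by (rule is_functor_comp[OF is_functor_regroup[OF C(4,1,2) eq(2,4) F(1-3) L]
              is_functor_dcat[OF is_functor_composables_cat[OF F(4)] wtC LC LQ]])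
      then show "is_functor (composable_cat (dcat K a b E0 E1 A) (dcat K a b E2 E12 B) (dcat K a b E1 E12 Q))
          (dcat K a b E1 E12 Q) (\<lambda>(g', g). prd (dcat K a b E0 E1 A) g' g)
          (\<lambda>(g', g). prd (dcat K a b E2 E12 B) g' g)"
        by (simp add: case_prod_unfold)
    qed (simp_all add: is_functor_dcat[OF F(1) wt[OF C(4)] LQ LP] is_functor_dcat[OF F(2) wt[OF C(4)] LQ LP]
        is_functor_dcat[OF F(3) wt[OF C(3)] LP LQ])
  qed (simp_all add: eq small_category_dcat C L LP LQ)
qed

section \<open>Natural categories\<close>

text \<open>A category object in functors of (E, X), with object functor of flags a, b and morphism
  functor of flags a', b'. The second clause is naturality of its structure maps with respect to
  arbitrary maps h. Every new edge of the recursion is an instance.\<close>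

definition natural_category :: "bool \<Rightarrow> bool \<Rightarrow> bool \<Rightarrow> bool \<Rightarrow> (('k, ('v, 'k) tup) module
    \<Rightarrow> ('v, 'k) tup set \<Rightarrow> (('v, 'k) tup, ('v, 'k) tup) small_cat) \<Rightarrow> bool" where
  "natural_category a b a' b' N \<longleftrightarrow>
     (\<forall>X E. linear_set K X E \<longrightarrow> small_category (N E X) \<and> Obj (N E X) = dset K a b E X
        \<and> Mor (N E X) = dset K a' b' E X) \<and>
     (\<forall>X E X' E' h. linear_set K X E \<longrightarrow> linear_set K X' E' \<longrightarrow> h \<in> X \<rightarrow> X' \<longrightarrow>
        is_functor (N E X) (N E' X') (dmap id K a b E E' h) (dmap id K a' b' E E' h))"

text \<open>Source, target and unit of C are maps h to which naturality of N applies directly. For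
  the product h is the product map on composable pairs, and the pairs of elements of N must first be
  identified, by regrouping, with N on the set of composable pairs.\<close>

lemma double_category_natural:
  assumes N: "natural_category a b a' b' N" and C: "small_category C"
    and Lo: "linear_set K (Obj C) Eo" and Lm: "linear_set K (Mor C) Em"
  shows "double_category (dcat K a b Eo Em C) (dcat K a' b' Eo Em C) (N Eo (Obj C)) (N Em (Mor C))"
proof -
  have NC: "small_category (N E X)" and [simp]: "Obj (N E X) = dset K a b E X" "Mor (N E X) = dset K a' b' E X"
    if "linear_set K X E" for E X
    using N that by (auto simp: natural_category_def)
  have nat: "is_functor (N E X) (N E' X') (dmap id K a b E E' h) (dmap id K a' b' E E' h)"
    if "linear_set K X E" "linear_set K X' E'" "h \<in> X \<rightarrow> X'" for E X E' X' h
    using N that by (auto simp: natural_category_def)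
  note LP = linear_set_pullback[OF Lm Lm, of "src C" "tgt C"]
  note c = small_categoryD[OF C] and wt = small_category_well_typed[OF C]
  let ?E = "Em \<times>\<^sub>m Em" and ?P = "composables C"
  let ?A = "dcat K a b Eo Em C" and ?B = "dcat K a' b' Eo Em C" and ?N = "N Em (Mor C)" and ?NP = "N ?E ?P"
  let ?K = "composable_cat ?A ?B ?N"
  have m: "(\<lambda>p. prd C (tfst p) (tsnd p)) \<in> ?P \<rightarrow> Mor C" and f: "tfst \<in> ?P \<rightarrow> Mor C"
    and s: "tsnd \<in> ?P \<rightarrow> Mor C"
    using c by (auto simp: pullback_def composable_iff)
  note Nf = is_functorD[OF nat[OF LP Lm f]] and Ns = is_functorD[OF nat[OF LP Lm s]]
  note NPc = small_categoryD[OF NC[OF LP]]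
  note [simp] = Lo Lm LP
  have qA: "regroup a p' p \<in> dset K a b ?E ?P"
    "dmap id K a b ?E Em tfst (regroup a p' p) = p'" "dmap id K a b ?E Em tsnd (regroup a p' p) = p"
    if "(p', p) \<in> composable ?A" for p' p
    using composable_dcat[OF Lo Lm wt that] by auto
  have qB: "regroup a' p' p \<in> dset K a' b' ?E ?P"
    "dmap id K a' b' ?E Em tfst (regroup a' p' p) = p'" "dmap id K a' b' ?E Em tsnd (regroup a' p' p) = p"
    if "(p', p) \<in> composable ?B" for p' p
    using composable_dcat[OF Lo Lm wt that] by auto
  have rA: "regroup a (dmap id K a b ?E Em tfst q) (dmap id K a b ?E Em tsnd q) = q"
    if "q \<in> dset K a b ?E ?P" for q
    by (rule regroup_projections[OF Lm Lm that])
  have rB: "regroup a' (dmap id K a' b' ?E Em tfst q) (dmap id K a' b' ?E Em tsnd q) = q"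
    if "q \<in> dset K a' b' ?E ?P" for q
    by (rule regroup_projections[OF Lm Lm that])
  \<comment> \<open>An element over the set of composable pairs is determined by its two derived
    projections, and naturality of N in \<open>tfst\<close> and \<open>tsnd\<close> computes those.
    Units and products below are compared in the same way.\<close>
  have srcR: "regroup a (src ?N p') (src ?N p) = src ?NP (regroup a' p' p)"
    and tgtR: "regroup a (tgt ?N p') (tgt ?N p) = tgt ?NP (regroup a' p' p)"
    if "(p', p) \<in> composable ?B" for p' p
    using rA[of "src ?NP (regroup a' p' p)"] rA[of "tgt ?NP (regroup a' p' p)"] NPc(1,2)[of "regroup a' p' p"]
      Nf(3,4)[of "regroup a' p' p"] Ns(3,4)[of "regroup a' p' p"] qB[OF that]
    by simp_all
  have "is_functor ?K ?NP (\<lambda>(p', p). regroup a p' p) (\<lambda>(p', p). regroup a' p' p)"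
  proof (rule is_functorI, goal_cases)
    case (1 x)
    then show ?case using qA(1) by (cases x) (auto simp: composable_cat_def)
  next
    case (2 x)
    then show ?case using qB(1) by (cases x) (auto simp: composable_cat_def)
  next
    case (3 x)
    then show ?case using srcR by (cases x) (auto simp: composable_cat_def)
  next
    case (4 x)
    then show ?case using tgtR by (cases x) (auto simp: composable_cat_def)
  next
    case (5 x)
    then obtain p' p where x: "x = (p', p)" and pp: "(p', p) \<in> composable ?A"
      by (cases x) (auto simp: composable_cat_def)
    let ?q = "regroup a p' p"
    have "regroup a' (unt ?N p') (unt ?N p) = unt ?NP ?q"
      using rB[of "unt ?NP ?q"] NPc(3)[of ?q] Nf(5)[of ?q] Ns(5)[of ?q] qA[OF pp] by simp
    then show ?case by (simp add: x composable_cat_def)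
  next
    case (6 h g)
    obtain h' h0 g' g0 where hg: "h = (h', h0)" "g = (g', g0)" by (cases h, cases g)
    have hh: "(h', h0) \<in> composable ?B" and gg: "(g', g0) \<in> composable ?B"
      and e: "tgt ?N g' = src ?N h'" "tgt ?N g0 = src ?N h0"
      using 6 by (auto simp: hg composable_iff composable_cat_def)
    let ?h = "regroup a' h' h0" and ?g = "regroup a' g' g0"
    have c: "(?h, ?g) \<in> composable ?NP"
      using qB(1)[OF hh] qB(1)[OF gg] srcR[OF hh] tgtR[OF gg] e by (simp add: composable_iff)
    have "regroup a' (prd ?N h' g') (prd ?N h0 g0) = prd ?NP ?h ?g"
      using rB[of "prd ?NP ?h ?g"] NPc(6)[OF c] Nf(6)[OF c] Ns(6)[OF c] qB[OF hh] qB[OF gg] by simp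
    then show ?case by (simp add: hg composable_cat_def)
  qed
  from is_functor_comp[OF this nat[OF LP Lm m]]
  have prd: "is_functor ?K ?N (\<lambda>(g', g). prd ?A g' g) (\<lambda>(g', g). prd ?B g' g)"
    by (simp add: case_prod_unfold)
  have sm: "src C \<in> Mor C \<rightarrow> Obj C" "tgt C \<in> Mor C \<rightarrow> Obj C" "unt C \<in> Obj C \<rightarrow> Mor C"
    using c by auto
  show ?thesis
  proof (rule double_categoryI)
    show "structure_maps_functorial ?A ?B (N Eo (Obj C)) ?N"
      unfolding structure_maps_functorial_def
      by (intro conjI prd) (simp_all only: dcat_simps nat[OF Lm Lo sm(1)] nat[OF Lm Lo sm(2)]
          nat[OF Lo Lm sm(3)])
  qed (simp_all add: NC[OF Lo] NC[OF Lm] small_category_dcat[OF C Lo Lm])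
qed

end

section \<open>The structure maps of first order\<close>

definition plain_cat :: "'k ring \<Rightarrow> bool \<Rightarrow> ('k, ('v, 'k) tup) module \<Rightarrow> ('v, 'k) tup set
    \<Rightarrow> (('v, 'k) tup, ('v, 'k) tup) small_cat" where
  "plain_cat K b E X = (if b then Gfi1b K E X else Gfi1 K E X)"

definition primed_cat :: "'k ring \<Rightarrow> bool \<Rightarrow> ('k, ('v, 'k) tup) module \<Rightarrow> ('v, 'k) tup set
    \<Rightarrow> (('v, 'k) tup, ('v, 'k) tup) small_cat" where
  "primed_cat K a E X = (if a then Gfi1b' K E X else Gfi1' K E X)"

lemma plain_cat_simps:
  "Obj (plain_cat K b E X) = dset K False b E X"
  "Mor (plain_cat K b E X) = dset K True b E X"
  "r \<in> scalars K b \<Longrightarrow> src (plain_cat K b E X) (x \<^bold>, v \<^bold>, r) = (x \<^bold>, r)"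
  "r \<in> scalars K b \<Longrightarrow> tgt (plain_cat K b E X) (x \<^bold>, v \<^bold>, r) = (x \<oplus>\<^bsub>E\<^esub> eff K r \<odot>\<^bsub>E\<^esub> v \<^bold>, r)"
  "r \<in> scalars K b \<Longrightarrow> unt (plain_cat K b E X) (x \<^bold>, r) = (x \<^bold>, \<zero>\<^bsub>E\<^esub> \<^bold>, r)"
  "r \<in> scalars K b \<Longrightarrow> r' \<in> scalars K b \<Longrightarrow>
     prd (plain_cat K b E X) (x' \<^bold>, v' \<^bold>, r') (x \<^bold>, v \<^bold>, r) = (x \<^bold>, v \<oplus>\<^bsub>E\<^esub> v' \<^bold>, r)"
  by (auto simp: plain_cat_def Gfi1_def Gfi1b_def dset_def scalars_def split: if_splits)

lemma primed_cat_simps: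
  "Obj (primed_cat K a E X) = dset K a False E X"
  "Mor (primed_cat K a E X) = dset K a True E X"
  "src (primed_cat K False E X) = del0 K" "src (primed_cat K True E X) = del0b K"
  "tgt (primed_cat K False E X) = del1" "tgt (primed_cat K True E X) = del1b E"
  "unt (primed_cat K False E X) = del_unt K" "unt (primed_cat K True E X) = del_untb K"
  "prd (primed_cat K False E X) = del_prd K" "prd (primed_cat K True E X) = del_prdb K"
  by (auto simp: primed_cat_def Gfi1'_def Gfi1b'_def dset_def)

lemma scalars_False_iff: "r \<in> scalars K False \<longleftrightarrow> (\<exists>t\<in>Units K. r = Scal t)"
  and scalars_True_iff: "r \<in> scalars K True \<longleftrightarrow> (\<exists>s\<in>Units K. \<exists>t\<in>Units K. r = (Scal s \<^bold>, Scal t))"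
  by (auto simp: scalars_def)

context unital_scalars
begin

lemma shift_add:
  assumes "module K E" "x \<in> carrier E" "v \<in> carrier E" "v' \<in> carrier E" "c \<in> carrier K"
  shows "x \<oplus>\<^bsub>E\<^esub> c \<odot>\<^bsub>E\<^esub> (v \<oplus>\<^bsub>E\<^esub> v') = (x \<oplus>\<^bsub>E\<^esub> c \<odot>\<^bsub>E\<^esub> v) \<oplus>\<^bsub>E\<^esub> c \<odot>\<^bsub>E\<^esub> v'"
proof -
  interpret module K E by fact
  show ?thesis using assms by (simp add: smult_r_distr M.a_assoc)
qed

lemma eff_carrier: "r \<in> scalars K b \<Longrightarrow> eff K r \<in> carrier K"
  by (simp add: eff_Units Units_closed)

lemma small_groupoid_plain_cat:
  assumes L: "linear_set K X E"
  shows "small_groupoid (plain_cat K b E X)"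
proof -
  interpret module K E using L by blast
  note E = module_axioms
  let ?C = "plain_cat K b E X"
  note [simp] = plain_cat_simps linear_set_carrier[OF L] eff_carrier
  have M: "\<exists>x v r. g = (x \<^bold>, v \<^bold>, r) \<and> x \<in> X \<and> v \<in> carrier E \<and> r \<in> scalars K b
      \<and> x \<oplus>\<^bsub>E\<^esub> eff K r \<odot>\<^bsub>E\<^esub> v \<in> X" if "g \<in> Mor ?C" for g
    using that by (simp add: dset_True)
  have O: "\<exists>x r. g = (x \<^bold>, r) \<and> x \<in> X \<and> r \<in> scalars K b" if "g \<in> Obj ?C" for g
    using that by (simp add: dset_False)
  have "small_category ?C"
    unfolding small_category_def
  proof (intro conjI funcsetI ballI allI impI; (clarify; drule O M)?)
    fix g assume "g \<in> Mor ?C"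
    from M[OF this] show "src ?C g \<in> Obj ?C" "tgt ?C g \<in> Obj ?C"
      "prd ?C g (unt ?C (src ?C g)) = g" "prd ?C (unt ?C (tgt ?C g)) g = g"
      by (auto simp: dset_False)
  next
    fix x assume "x \<in> Obj ?C"
    from O[OF this] show "unt ?C x \<in> Mor ?C" "src ?C (unt ?C x) = x" "tgt ?C (unt ?C x) = x"
      by (auto simp: dset_True)
  next
    fix z assume "z \<in> composable ?C"
    then obtain g' g where z: "z = (g', g)" "g' \<in> Mor ?C" "g \<in> Mor ?C" "tgt ?C g = src ?C g'"
      by (auto simp: composable_def)
    from M[OF z(2)] M[OF z(3)] z(4)
    show "case z of (g', g) \<Rightarrow> prd ?C g' g \<in> Mor ?C \<and> src ?C (prd ?C g' g) = src ?C g \<and> tgt ?C (prd ?C g' g) = tgt ?C g'"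
      by (auto simp: z(1) dset_True shift_add[OF E])
  next
    fix g'' g' g assume "(g'', g') \<in> composable ?C" "(g', g) \<in> composable ?C"
    then have "g'' \<in> Mor ?C" "g' \<in> Mor ?C" "g \<in> Mor ?C" by (auto simp: composable_def)
    from M[OF this(1)] M[OF this(2)] M[OF this(3)]
    show "prd ?C g'' (prd ?C g' g) = prd ?C (prd ?C g'' g') g"
      by (auto simp: M.a_assoc)
  qed
  moreover have "\<exists>g'\<in>Mor ?C. src ?C g' = tgt ?C g \<and> tgt ?C g' = src ?C g \<and>
        prd ?C g' g = unt ?C (src ?C g) \<and> prd ?C g g' = unt ?C (tgt ?C g)" if g: "g \<in> Mor ?C" for g
  proof -
    obtain x v r where xvr: "g = (x \<^bold>, v \<^bold>, r)" "x \<in> X" "v \<in> carrier E" "r \<in> scalars K b"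
      "x \<oplus>\<^bsub>E\<^esub> eff K r \<odot>\<^bsub>E\<^esub> v \<in> X"
      using M[OF g] by blast
    have "(x \<oplus>\<^bsub>E\<^esub> eff K r \<odot>\<^bsub>E\<^esub> v) \<oplus>\<^bsub>E\<^esub> eff K r \<odot>\<^bsub>E\<^esub> (\<ominus>\<^bsub>E\<^esub> v) = x"
      using xvr by (simp add: shift_add[OF E, symmetric] M.r_neg)
    \<comment> \<open>The inverse starts at the endpoint and steps back by the opposite vector with
      the same scalars.\<close>
    then show ?thesis
      using xvr by (intro bexI[of _ "(x \<oplus>\<^bsub>E\<^esub> eff K r \<odot>\<^bsub>E\<^esub> v) \<^bold>, \<ominus>\<^bsub>E\<^esub> v \<^bold>, r"])
        (auto simp: dset_True M.r_neg M.l_neg)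
  qed
  ultimately show ?thesis by (simp add: small_groupoid_def)
qed

lemma small_category_plain_cat: "linear_set K X E \<Longrightarrow> small_category (plain_cat K b E X)"
  using small_groupoid_plain_cat by (auto simp: small_groupoid_def)

text \<open>As h acts on both endpoints, source and target are immediate. Preservation of units and
  products says that quotients with a fixed unit vanish between equal endpoints and telescope along
  consecutive ones.\<close>

lemma is_functor_plain_cat:
  assumes L: "linear_set K X E" and L': "linear_set K X' E'" and h: "h \<in> X \<rightarrow> X'"
  shows "is_functor (plain_cat K b E X) (plain_cat K b E' X') (dmap u K False b E E' h) (dmap u K True b E E' h)"
proof -
  interpret E: module K E using L by blast
  interpret E': module K E' using L' by blast
  let ?C = "plain_cat K b E X"
  note [simp] = plain_cat_simps linear_set_carrier[OF L] linear_set_carrier[OF L'] eff_carrier eff_Units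
    funcset_mem[OF h] dmap_True
  have M: "\<exists>x v r. g = (x \<^bold>, v \<^bold>, r) \<and> x \<in> X \<and> v \<in> carrier E \<and> r \<in> scalars K b
      \<and> x \<oplus>\<^bsub>E\<^esub> eff K r \<odot>\<^bsub>E\<^esub> v \<in> X" if "g \<in> Mor ?C" for g
    using that by (simp add: dset_True)
  show ?thesis
  proof (rule is_functorI)
    fix g assume g: "g \<in> Mor ?C"
    from M[OF g] show "dmap u K True b E E' h g \<in> Mor (plain_cat K b E' X')"
      using dmap_in[OF L L' h, of g True b u] g by simp
    from M[OF g] show "src (plain_cat K b E' X') (dmap u K True b E E' h g) = dmap u K False b E E' h (src ?C g)"
      by auto
    from M[OF g] show "tgt (plain_cat K b E' X') (dmap u K True b E E' h g) = dmap u K False b E E' h (tgt ?C g)"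
      by (auto simp: add_smult_quot[OF E'.module_axioms])
  next
    fix x assume x: "x \<in> Obj ?C"
    show "dmap u K False b E E' h x \<in> Obj (plain_cat K b E' X')"
      using dmap_in[OF L L' h, of x False b u] x by simp
    have "quot K E' c y y = \<zero>\<^bsub>E'\<^esub>" if "c \<in> Units K" "y \<in> carrier E'" for c y
      by (rule quot_eqI[OF E'.module_axioms]) (use that in \<open>auto simp: Units_closed\<close>)
    with x show "dmap u K True b E E' h (unt ?C x) = unt (plain_cat K b E' X') (dmap u K False b E E' h x)"
      by (auto simp: dset_False)
  next
    fix g' g assume "(g', g) \<in> composable ?C"
    then have g: "g' \<in> Mor ?C" "g \<in> Mor ?C" "tgt ?C g = src ?C g'" by (auto simp: composable_def)
    obtain x v r v' where *: "g = (x \<^bold>, v \<^bold>, r)" "x \<in> X" "v \<in> carrier E" "r \<in> scalars K b"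
      "x \<oplus>\<^bsub>E\<^esub> eff K r \<odot>\<^bsub>E\<^esub> v \<in> X"
      "g' = ((x \<oplus>\<^bsub>E\<^esub> eff K r \<odot>\<^bsub>E\<^esub> v) \<^bold>, v' \<^bold>, r)" "v' \<in> carrier E"
      "(x \<oplus>\<^bsub>E\<^esub> eff K r \<odot>\<^bsub>E\<^esub> v) \<oplus>\<^bsub>E\<^esub> eff K r \<odot>\<^bsub>E\<^esub> v' \<in> X"
      using M[OF g(1)] M[OF g(2)] g(3) by auto
    have "quot K E' c y z \<oplus>\<^bsub>E'\<^esub> quot K E' c z w = quot K E' c y w"
      if "c \<in> Units K" "y \<in> carrier E'" "z \<in> carrier E'" "w \<in> carrier E'" for c y z w
      by (rule quot_eqI[OF E'.module_axioms, symmetric])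
        (use that in \<open>auto simp: Units_closed shift_add[OF E'.module_axioms] E'.module_axioms\<close>)
    then show "dmap u K True b E E' h (prd ?C g' g)
        = prd (plain_cat K b E' X') (dmap u K True b E E' h g') (dmap u K True b E E' h g)"
      using * by (simp add: shift_add[OF E.module_axioms])
  qed
qed

lemma plain_functor_unique:
  assumes L: "linear_set K X E" and L': "linear_set K X' E'" and h: "h \<in> X \<rightarrow> X'"
    and G: "is_functor (plain_cat K b E X) (plain_cat K b E' X') Go Gm"
    and Go: "\<And>p. p \<in> dset K False b E X \<Longrightarrow> Go p = dmap u K False b E E' h p"
    and g: "g \<in> dset K True b E X"
  shows "Gm g = dmap u K True b E E' h g"
proof -
  interpret E': module K E' using L' by blast
  obtain x v r where x: "g = (x \<^bold>, v \<^bold>, r)" "x \<in> X" "v \<in> carrier E" "r \<in> scalars K b"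
    "x \<oplus>\<^bsub>E\<^esub> eff K r \<odot>\<^bsub>E\<^esub> v \<in> X"
    using g by (auto simp: dset_True)
  obtain y w r' where y: "Gm g = (y \<^bold>, w \<^bold>, r')" "y \<in> X'" "w \<in> carrier E'" "r' \<in> scalars K b"
    using is_functorD(2)[OF assms(4), of g] g by (auto simp: dset_True plain_cat_simps)
  have "(y \<^bold>, r') = Go (x \<^bold>, r)" "(y \<oplus>\<^bsub>E'\<^esub> eff K r' \<odot>\<^bsub>E'\<^esub> w \<^bold>, r') = Go (x \<oplus>\<^bsub>E\<^esub> eff K r \<odot>\<^bsub>E\<^esub> v \<^bold>, r)"
    using is_functorD(3,4)[OF assms(4), of g] g x y by (simp_all add: plain_cat_simps)
  then have *: "y = h x" "r' = map_tup u id r" "y \<oplus>\<^bsub>E'\<^esub> eff K r' \<odot>\<^bsub>E'\<^esub> w = h (x \<oplus>\<^bsub>E\<^esub> eff K r \<odot>\<^bsub>E\<^esub> v)"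
    using x by (simp_all add: Go dset_False)
  \<comment> \<open>The source has fixed the base point and the scalars; the vector w is then solved
    for from the target, the effective scalar being invertible.\<close>
  moreover have "quot K E' (eff K r) y (h (x \<oplus>\<^bsub>E\<^esub> eff K r \<odot>\<^bsub>E\<^esub> v)) = w"
    using * x y linear_set_carrier[OF L']
    by (intro quot_eqI[OF E'.module_axioms]) (auto simp: eff_Units)
  ultimately show ?thesis
    using x y by (simp add: dmap_True)
qed

lemma small_category_primed_cat:
  assumes L: "linear_set K X E"
  shows "small_category (primed_cat K a E X)"
proof -
  interpret module K E using L by blast
  note [simp] = primed_cat_simps linear_set_carrier[OF L] Units_closed
  show ?thesis
  proof (cases a)
    case False
    then have a: "a = False" by simp
    show ?thesis unfolding small_category_def a
      by (auto simp: dset_False scalars_False_iff scalars_True_iff composable_iff m_ac)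
  next
    case True
    have *: "s \<odot>\<^bsub>E\<^esub> (t \<odot>\<^bsub>E\<^esub> v) = (t \<otimes>\<^bsub>K\<^esub> s) \<odot>\<^bsub>E\<^esub> v" "t \<odot>\<^bsub>E\<^esub> (s \<odot>\<^bsub>E\<^esub> v) = (t \<otimes>\<^bsub>K\<^esub> s) \<odot>\<^bsub>E\<^esub> v"
      if "s \<in> Units K" "t \<in> Units K" "v \<in> carrier E" for s t v
      using that by (simp_all add: smult_assoc1[symmetric] m_comm)
    \<comment> \<open>The target map scales v by s and drops s from the scalars, so the total
      displacement (st)v = t(sv) and the endpoint are unchanged.\<close>
    have **: "x \<oplus>\<^bsub>E\<^esub> t \<odot>\<^bsub>E\<^esub> (s \<odot>\<^bsub>E\<^esub> v) \<in> X" if "x \<oplus>\<^bsub>E\<^esub> (s \<otimes>\<^bsub>K\<^esub> t) \<odot>\<^bsub>E\<^esub> v \<in> X"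
      "s \<in> Units K" "t \<in> Units K" "v \<in> carrier E" for x s t v
      using that by (simp add: smult_assoc1[symmetric] m_comm)
    from True have a: "a = True" by simp
    show ?thesis unfolding small_category_def a
      by (auto simp: dset_True scalars_False_iff scalars_True_iff composable_iff m_ac * **)
  qed
qed

lemma is_functor_primed_cat:
  assumes L: "linear_set K X E" and L': "linear_set K X' E'" and h: "h \<in> X \<rightarrow> X'"
  shows "is_functor (primed_cat K a E X) (primed_cat K a E' X') (dmap u K a False E E' h) (dmap u K a True E E' h)"
proof -
  interpret E: module K E using L by blast
  interpret E': module K E' using L' by blast
  note [simp] = primed_cat_simps linear_set_carrier[OF L] linear_set_carrier[OF L'] eff_carrier eff_Units
    funcset_mem[OF h] Units_closed
  \<comment> \<open>Both sides solve y + t w = z. This is compatibility of difference quotients with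
    the target map of direction k'.\<close>
  have q: "s \<odot>\<^bsub>E'\<^esub> quot K E' (s \<otimes>\<^bsub>K\<^esub> t) y z = quot K E' t y z"
    if "s \<in> Units K" "t \<in> Units K" "y \<in> carrier E'" "z \<in> carrier E'" for s t y z
  proof (rule quot_eqI[OF E'.module_axioms, symmetric])
    have "t \<odot>\<^bsub>E'\<^esub> (s \<odot>\<^bsub>E'\<^esub> quot K E' (s \<otimes>\<^bsub>K\<^esub> t) y z) = (s \<otimes>\<^bsub>K\<^esub> t) \<odot>\<^bsub>E'\<^esub> quot K E' (s \<otimes>\<^bsub>K\<^esub> t) y z"
      using that E'.module_axioms by (simp add: E'.smult_assoc1[symmetric] m_comm)
    then show "y \<oplus>\<^bsub>E'\<^esub> t \<odot>\<^bsub>E'\<^esub> (s \<odot>\<^bsub>E'\<^esub> quot K E' (s \<otimes>\<^bsub>K\<^esub> t) y z) = z"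
      using that E'.module_axioms by simp
  qed (use that E'.module_axioms in auto)
  have s: "t \<odot>\<^bsub>E\<^esub> (s \<odot>\<^bsub>E\<^esub> v) = (s \<otimes>\<^bsub>K\<^esub> t) \<odot>\<^bsub>E\<^esub> v"
    if "s \<in> Units K" "t \<in> Units K" "v \<in> carrier E" for s t v
    using that by (simp add: E.smult_assoc1[symmetric] m_comm)
  have in_o: "x \<in> dset K a False E X \<Longrightarrow> dmap u K a False E E' h x \<in> dset K a False E' X'"
    and in_m: "x \<in> dset K a True E X \<Longrightarrow> dmap u K a True E E' h x \<in> dset K a True E' X'" for x
    by (rule dmap_in[OF L L' h]; assumption)+
  show ?thesis
  proof (cases a)
    case False
    then have a: "a = False" by simp
    show ?thesis unfolding a
      by (rule is_functorI; (simp add: in_o[unfolded a] in_m[unfolded a])?)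
        (auto simp: dset_False scalars_False_iff scalars_True_iff composable_iff)
  next
    case True
    then have a: "a = True" by simp
    show ?thesis unfolding a
      by (rule is_functorI; (simp add: in_o[unfolded a] in_m[unfolded a])?)
        (auto simp: dset_True scalars_False_iff scalars_True_iff composable_iff q s m_ac)
  qed
qed

text \<open>The source records st and the target records t; cancelling the unit t recovers s. This
  settles the vertex {k'}, from which {k,k'} is then reached by a plain edge.\<close>

lemma primed_functor_unique:
  assumes L: "linear_set K X E" and L': "linear_set K X' E'" and h: "h \<in> X \<rightarrow> X'"
    and G: "is_functor (primed_cat K False E X) (primed_cat K False E' X') Go Gm"
    and Go: "\<And>p. p \<in> dset K False False E X \<Longrightarrow> Go p = dmap u K False False E E' h p"
    and g: "g \<in> dset K False True E X"
  shows "Gm g = dmap u K False True E E' h g"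
proof -
  obtain x s t where x: "g = (x \<^bold>, Scal s \<^bold>, Scal t)" "x \<in> X" "s \<in> Units K" "t \<in> Units K"
    using g by (auto simp: dset_False scalars_True_iff)
  obtain y s' t' where y: "Gm g = (y \<^bold>, Scal s' \<^bold>, Scal t')" "y \<in> X'" "s' \<in> Units K" "t' \<in> Units K"
    using is_functorD(2)[OF G, of g] g by (auto simp: dset_False scalars_True_iff primed_cat_simps)
  have "(y \<^bold>, Scal (s' \<otimes>\<^bsub>K\<^esub> t')) = Go (x \<^bold>, Scal (s \<otimes>\<^bsub>K\<^esub> t))" "(y \<^bold>, Scal t') = Go (x \<^bold>, Scal t)"
    using is_functorD(3,4)[OF G, of g] g x y by (simp_all add: primed_cat_simps)
  then have *: "y = h x" "s' \<otimes>\<^bsub>K\<^esub> t' = s \<otimes>\<^bsub>K\<^esub> t" "t' = t"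
    using x by (simp_all add: Go dset_False scalars_False_iff)
  then have "s' = s"
    using x y by (metis Units_closed Units_r_inv m_assoc r_one Units_inv_closed)
  then show ?thesis using x y * by simp
qed

text \<open>Linearity of the module action makes the two directions compatible: \<open>del1b\<close>
  scales increments and \<open>pi_prd\<close> adds them, while (st)v = t(sv) makes the targets
  agree.\<close>

lemma double_category_first_order:
  assumes L: "linear_set K X E"
  shows "double_category (plain_cat K False E X) (plain_cat K True E X)
    (primed_cat K False E X) (primed_cat K True E X)"
proof -
  interpret module K E using L by blast
  let ?A = "plain_cat K False E X" and ?B = "plain_cat K True E X"
    and ?P = "primed_cat K False E X" and ?Q = "primed_cat K True E X"
  note [simp] = primed_cat_simps linear_set_carrier[OF L] Units_closed
  have [simp]: "s \<odot>\<^bsub>E\<^esub> (t \<odot>\<^bsub>E\<^esub> v) = (t \<otimes>\<^bsub>K\<^esub> s) \<odot>\<^bsub>E\<^esub> v"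
    if "s \<in> Units K" "t \<in> Units K" "v \<in> carrier E" for s t v
    using that by (simp_all add: smult_assoc1[symmetric] m_comm)
  have A: "Obj ?A = dset K False False E X" "Mor ?A = dset K True False E X"
    "src ?A = pi0" "tgt ?A = pi1 E" "unt ?A = pi_unt E" "prd ?A = pi_prd E"
    and B: "Obj ?B = dset K False True E X" "Mor ?B = dset K True True E X"
    "src ?B = pi0b" "tgt ?B = pi1b K E" "unt ?B = pi_untb E" "prd ?B = pi_prdb E"
    by (auto simp: plain_cat_def Gfi1_def Gfi1b_def dset_def)
  note S = dset_False dset_True scalars_False_iff scalars_True_iff composable_iff m_ac A B
  show ?thesis
  proof (rule double_categoryI)
    show "structure_maps_functorial ?A ?B ?P ?Q"
      unfolding structure_maps_functorial_def
    proof (intro conjI)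
      show "is_functor ?Q ?P (src ?A) (src ?B)"
        by (rule is_functorI) (auto simp: S)
      show "is_functor ?Q ?P (tgt ?A) (tgt ?B)"
        by (rule is_functorI) (auto simp: S)
      show "is_functor ?P ?Q (unt ?A) (unt ?B)"
        by (rule is_functorI) (auto simp: S)
      show "is_functor (composable_cat ?A ?B ?Q) ?Q (\<lambda>(g', g). prd ?A g' g) (\<lambda>(g', g). prd ?B g' g)"
        by (rule is_functorI) (auto simp: S composable_cat_def smult_r_distr M.a_assoc)
    qed
  qed (simp_all add: A B small_category_plain_cat[OF L] small_category_primed_cat[OF L])
qed

end

section \<open>Existence and uniqueness\<close>

context unital_scalars
begin

lemma natural_category_plain_cat: "natural_category False b True b (plain_cat K b)"
  by (auto simp: natural_category_def plain_cat_simps(1,2) small_category_plain_cat is_functor_plain_cat)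

lemma natural_category_primed_cat: "natural_category a False a True (primed_cat K a)"
  by (auto simp: natural_category_def primed_cat_simps(1,2) small_category_primed_cat is_functor_primed_cat)

lemma small_groupoid_dcat:
  assumes G: "small_groupoid C" and Lo: "linear_set K (Obj C) Eo" and Lm: "linear_set K (Mor C) Em"
  shows "small_groupoid (dcat K a b Eo Em C)"
proof -
  have C: "small_category C" using G by (simp add: small_groupoid_def)
  note c = small_categoryD[OF C]
  have "\<forall>g\<in>Mor C. \<exists>g'\<in>Mor C. src C g' = tgt C g \<and> tgt C g' = src C g \<and>
        prd C g' g = unt C (src C g) \<and> prd C g g' = unt C (tgt C g)"
    using G by (simp add: small_groupoid_def)
  \<comment> \<open>Inversion is chosen as a map on morphisms so that it can be derived; the derived
    map inverts because the inverse laws are equations between maps.\<close>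
  then obtain j where j: "\<And>g. g \<in> Mor C \<Longrightarrow> j g \<in> Mor C" "\<And>g. g \<in> Mor C \<Longrightarrow> src C (j g) = tgt C g"
    "\<And>g. g \<in> Mor C \<Longrightarrow> tgt C (j g) = src C g" "\<And>g. g \<in> Mor C \<Longrightarrow> prd C (j g) g = unt C (src C g)"
    "\<And>g. g \<in> Mor C \<Longrightarrow> prd C g (j g) = unt C (tgt C g)"
    by metis
  let ?D = "dcat K a b Eo Em C" and ?T = "dmap id K a b" and ?E = "Em \<times>\<^sub>m Em"
  let ?m = "\<lambda>p. prd C (tfst p) (tsnd p)"
  note LP = linear_set_pullback[OF Lm Lm, of "src C" "tgt C"]
  have jm: "j \<in> Mor C \<rightarrow> Mor C" using j by auto
  have "\<exists>g'\<in>Mor ?D. src ?D g' = tgt ?D g \<and> tgt ?D g' = src ?D g \<and>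
        prd ?D g' g = unt ?D (src ?D g) \<and> prd ?D g g' = unt ?D (tgt ?D g)" if "g \<in> Mor ?D" for g
  proof (intro bexI conjI)
    have g: "g \<in> dset K a b Em (Mor C)" using that by simp
    let ?g' = "?T Em Em j g"
    show "?g' \<in> Mor ?D" using dmap_in[OF Lm Lm jm g] by simp
    have "?T Em Eo (src C) ?g' = ?T Em Eo (\<lambda>x. src C (j x)) g"
      by (rule dmap_comp[OF Lm Lm jm g])
    also have "\<dots> = ?T Em Eo (tgt C) g" by (rule dmap_cong[OF g]) (simp add: j)
    finally show "src ?D ?g' = tgt ?D g" by simp
    have "?T Em Eo (tgt C) ?g' = ?T Em Eo (\<lambda>x. tgt C (j x)) g"
      by (rule dmap_comp[OF Lm Lm jm g])
    also have "\<dots> = ?T Em Eo (src C) g" by (rule dmap_cong[OF g]) (simp add: j)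
    finally show "tgt ?D ?g' = src ?D g" by simp
    have g0: "?T Em Em (\<lambda>x. x) g = g" by (rule dmap_ident[OF Lm g]) simp
    have "?T ?E Em ?m (regroup a ?g' g) = ?T ?E Em ?m (?T Em ?E (\<lambda>x. j x \<^bold>, x) g)"
      using regroup_dmap[OF Lm Lm Lm jm _ g, of "\<lambda>x. x" id] g0 by simp
    also have "\<dots> = ?T Em Em (\<lambda>x. ?m (j x \<^bold>, x)) g"
      by (rule dmap_comp[OF Lm LP _ g]) (simp add: j composable_iff)
    also have "\<dots> = ?T Em Em (\<lambda>x. unt C (src C x)) g"
      by (rule dmap_cong[OF g]) (simp add: j)
    also have "\<dots> = ?T Eo Em (unt C) (?T Em Eo (src C) g)"
      by (rule dmap_comp[OF Lm Lo _ g, symmetric]) (simp add: c)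
    finally show "prd ?D ?g' g = unt ?D (src ?D g)" by simp
    have "?T ?E Em ?m (regroup a g ?g') = ?T ?E Em ?m (?T Em ?E (\<lambda>x. x \<^bold>, j x) g)"
      using regroup_dmap[OF Lm Lm Lm _ jm g, of "\<lambda>x. x" id] g0 by simp
    also have "\<dots> = ?T Em Em (\<lambda>x. ?m (x \<^bold>, j x)) g"
      by (rule dmap_comp[OF Lm LP _ g]) (simp add: j composable_iff)
    also have "\<dots> = ?T Em Em (\<lambda>x. unt C (tgt C x)) g"
      by (rule dmap_cong[OF g]) (simp add: j)
    also have "\<dots> = ?T Eo Em (unt C) (?T Em Eo (tgt C) g)"
      by (rule dmap_comp[OF Lm Lo _ g, symmetric]) (simp add: c)
    finally show "prd ?D g ?g' = unt ?D (tgt ?D g)" by simp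
  qed
  then show ?thesis
    unfolding small_groupoid_def using small_category_dcat[OF C Lo Lm] by blast
qed

end

section \<open>The recursion through the vertex functors, and its unprimed part\<close>

abbreviation dirs :: "nat \<Rightarrow> dir set" where
  "dirs n \<equiv> Plain ` {1..n} \<union> Primed ` {1..n}"

abbreviation old :: "nat \<Rightarrow> dir set \<Rightarrow> dir set" where
  "old n \<alpha> \<equiv> \<alpha> - {Plain (Suc n), Primed (Suc n)}"

lemma index_Gfib: "index (Gfib K U V n) = dirs n"
  by (cases n) auto

lemma index_Gfi: "index (Gfi K U V n) = {1..n}"
  by (cases n) auto

lemma ambientb_Suc: "ambientb K V (Suc n) \<alpha> =
    dmod K (Plain (Suc n) \<in> \<alpha>) (Primed (Suc n) \<in> \<alpha>) (ambientb K V n (old n \<alpha>))"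
  by (simp add: dmod_def Let_def)

lemma vertex_Gfib_Suc: "vertex (Gfib K U V (Suc n)) \<alpha> =
    dset K (Plain (Suc n) \<in> \<alpha>) (Primed (Suc n) \<in> \<alpha>) (ambientb K V n (old n \<alpha>))
      (vertex (Gfib K U V n) (old n \<alpha>))"
  by (simp add: dset_def Let_def)

lemma edge_Gfib_Suc: "edge (Gfib K U V (Suc n)) \<beta> i =
    (let E = ambientb K V n (old n \<beta>); X = vertex (Gfib K U V n) (old n \<beta>) in
     if i = Plain (Suc n) then plain_cat K (Primed (Suc n) \<in> \<beta>) E X
     else if i = Primed (Suc n) then primed_cat K (Plain (Suc n) \<in> \<beta>) E X
     else dcat K (Plain (Suc n) \<in> \<beta>) (Primed (Suc n) \<in> \<beta>) E (ambientb K V n (insert i (old n \<beta>)))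
       (edge (Gfib K U V n) (old n \<beta>) i))"
  by (simp add: Let_def plain_cat_def primed_cat_def dcat_def dset_def regroup_def
      dmap_eq_times_id dmap_eq_slope dmap_eq_slopeb)

lemmas [simp del] = Gfib.simps(2) ambientb.simps(2)

lemma image_Plain_old: "old n (Plain ` \<alpha>) = Plain ` (\<alpha> - {Suc n})"
  by auto

lemma mem_image_Plain [simp]: "Plain k \<in> Plain ` \<alpha> \<longleftrightarrow> k \<in> \<alpha>" "Primed k \<notin> Plain ` \<alpha>"
  by auto

text \<open>With this and the two lemmas after it, the n-fold construction is read off from the
  2n-fold one at the vertices made of plain directions, where every flag b is
  \<open>False\<close>.\<close>

lemma ambient_eq: "ambient K V n \<alpha> = ambientb K V n (Plain ` \<alpha>)"
  by (induction n arbitrary: \<alpha>) (auto simp: ambientb_Suc dmod_def Let_def image_Plain_old)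

lemma vertex_Gfi_eq: "vertex (Gfi K U V n) \<alpha> = vertex (Gfib K U V n) (Plain ` \<alpha>)"
  by (induction n arbitrary: \<alpha>)
    (auto simp: vertex_Gfib_Suc dset_def Let_def image_Plain_old ambient_eq)

lemma edge_Gfi_eq: "i \<in> {1..n} \<Longrightarrow> edge (Gfi K U V n) \<beta> i = edge (Gfib K U V n) (Plain ` \<beta>) (Plain i)"
proof (induction n arbitrary: \<beta> i)
  case (Suc n)
  then show ?case
    by (cases "i = Suc n")
      (auto simp: Gfib.simps(2) Let_def image_Plain_old ambient_eq vertex_Gfi_eq)
qed simp

lemmas [simp del] = Gfi.simps(2)

lemma mfold_category_edge:
  assumes "mfold_category C" "\<beta> \<subseteq> index C" "i \<in> index C - \<beta>"
  shows "small_category (edge C \<beta> i)" "Obj (edge C \<beta> i) = vertex C \<beta>"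
    "Mor (edge C \<beta> i) = vertex C (insert i \<beta>)"
  using assms(1)[unfolded mfold_category_def, THEN conjunct2, THEN conjunct1, rule_format, OF assms(2,3)]
  by simp_all

lemma mfold_category_face:
  assumes "mfold_category C" "\<beta> \<subseteq> index C" "i \<in> index C - \<beta>" "j \<in> index C - \<beta>" "i \<noteq> j"
  shows "double_category (edge C \<beta> i) (edge C (insert j \<beta>) i) (edge C \<beta> j) (edge C (insert i \<beta>) j)"
  using assms(1)[unfolded mfold_category_def, THEN conjunct2, THEN conjunct2, rule_format, OF assms(2-5)] .

lemma mfold_category_morphism_functor:
  assumes "mfold_category_morphism C D F" "\<beta> \<subseteq> index C" "i \<in> index C - \<beta>"
  shows "is_functor (edge C \<beta> i) (edge D \<beta> i) (F \<beta>) (F (insert i \<beta>))"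
  using assms(1)[unfolded mfold_category_morphism_def, THEN conjunct2, THEN conjunct2, THEN conjunct2,
      THEN conjunct2, rule_format, OF assms(2,3)] .

lemma mfold_category_morphism_eqI:
  assumes "mfold_category_morphism C D F" "mfold_category_morphism C D G"
    and "\<And>\<alpha> x. \<alpha> \<subseteq> index C \<Longrightarrow> x \<in> vertex C \<alpha> \<Longrightarrow> F \<alpha> x = G \<alpha> x"
  shows "F = G"
proof -
  have P: "F \<in> (\<Pi>\<^sub>E \<alpha>\<in>Pow (index C). vertex C \<alpha> \<rightarrow>\<^sub>E vertex D \<alpha>)"
    "G \<in> (\<Pi>\<^sub>E \<alpha>\<in>Pow (index C). vertex C \<alpha> \<rightarrow>\<^sub>E vertex D \<alpha>)"
    using assms(1,2)[unfolded mfold_category_morphism_def, THEN conjunct2, THEN conjunct2,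
        THEN conjunct2, THEN conjunct1] .
  show ?thesis
  proof (rule PiE_ext[OF P])
    fix \<alpha> assume a: "\<alpha> \<in> Pow (index C)"
    show "F \<alpha> = G \<alpha>"
      by (rule PiE_ext[OF PiE_mem[OF P(1) a] PiE_mem[OF P(2) a]]) (rule assms(3)[OF PowD[OF a]])
  qed
qed

text \<open>The natural formulas for vertex maps are total functions; cutting them down to the
  vertex sets gives the extensional representative demanded of a morphism.\<close>

lemma mfold_category_morphism_restrictI:
  assumes C: "mfold_category C" and D: "mfold_category D" and "index C = index D"
    and V: "\<And>\<alpha>. \<alpha> \<subseteq> index C \<Longrightarrow> F \<alpha> \<in> vertex C \<alpha> \<rightarrow> vertex D \<alpha>"
    and F: "\<And>\<beta> i. \<beta> \<subseteq> index C \<Longrightarrow> i \<in> index C - \<beta> \<Longrightarrow>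
      is_functor (edge C \<beta> i) (edge D \<beta> i) (F \<beta>) (F (insert i \<beta>))"
  shows "mfold_category_morphism C D (\<lambda>\<alpha>\<in>Pow (index C). restrict (F \<alpha>) (vertex C \<alpha>))"
  unfolding mfold_category_morphism_def
proof (intro conjI allI impI)
  fix \<beta> i assume b: "\<beta> \<subseteq> index C" "i \<in> index C - \<beta>"
  have "small_category (edge C \<beta> i)" "Obj (edge C \<beta> i) = vertex C \<beta>"
    "Mor (edge C \<beta> i) = vertex C (insert i \<beta>)"
    using mfold_category_edge[OF C b] .
  with b show "is_functor (edge C \<beta> i) (edge D \<beta> i)
      ((\<lambda>\<alpha>\<in>Pow (index C). restrict (F \<alpha>) (vertex C \<alpha>)) \<beta>)
      ((\<lambda>\<alpha>\<in>Pow (index C). restrict (F \<alpha>) (vertex C \<alpha>)) (insert i \<beta>))"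
    by (intro is_functor_cong[OF F[OF b]]) auto
qed (use assms in auto)

context unital_scalars
begin

text \<open>Stated for every set of directions: level 0 ignores the vertex, so the induction carries
  no side condition.\<close>

lemma linear_set_vertex:
  assumes "linear_set K U V"
  shows "linear_set K (vertex (Gfib K U V n) \<alpha>) (ambientb K V n \<alpha>)"
proof (induction n arbitrary: \<alpha>)
  case 0
  then show ?case using assms by (auto simp: linear_set_def module_vec_module) (auto simp: vec_module_def)
next
  case (Suc n)
  show ?case unfolding vertex_Gfib_Suc ambientb_Suc by (rule linear_set_dset[OF Suc])
qed

text \<open>Faces of level n+1 are of three kinds. Two old directions give the derivation of a face
  of level n, an old and a new one give a naturality square, and the two new ones give the
  first-order double category.\<close>

lemma mfold_category_Gfib:
  assumes L: "linear_set K U V"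
  shows "mfold_category (Gfib K U V n)"
proof (induction n)
  case 0
  show ?case by (simp add: mfold_category_def)
next
  case (Suc n)
  let ?C = "Gfib K U V n" and ?D = "Gfib K U V (Suc n)" and ?a = "Plain (Suc n)" and ?b = "Primed (Suc n)"
  let ?A = "ambientb K V n"
  note Lv = linear_set_vertex[OF L]
  have IHe: "small_category (edge ?C \<gamma> i)" "Obj (edge ?C \<gamma> i) = vertex ?C \<gamma>"
    "Mor (edge ?C \<gamma> i) = vertex ?C (insert i \<gamma>)" if "\<gamma> \<subseteq> dirs n" "i \<in> dirs n - \<gamma>" for \<gamma> i
    using mfold_category_edge[OF Suc, unfolded index_Gfib, OF that] .
  have IHf: "double_category (edge ?C \<gamma> i) (edge ?C (insert j \<gamma>) i) (edge ?C \<gamma> j) (edge ?C (insert i \<gamma>) j)"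
    if "\<gamma> \<subseteq> dirs n" "i \<in> dirs n - \<gamma>" "j \<in> dirs n - \<gamma>" "i \<noteq> j" for \<gamma> i j
    using mfold_category_face[OF Suc, unfolded index_Gfib, OF that] .
  have dirs_Suc: "dirs (Suc n) = dirs n \<union> {?a, ?b}"
    by (auto simp: atLeastAtMostSuc_conv)
  have new: "?a \<notin> dirs n" "?b \<notin> dirs n" by auto
  have Le: "linear_set K (Obj (edge ?C \<gamma> i)) (?A \<gamma>)" "linear_set K (Mor (edge ?C \<gamma> i)) (?A (insert i \<gamma>))"
    if "\<gamma> \<subseteq> dirs n" "i \<in> dirs n - \<gamma>" for \<gamma> i
    using IHe[OF that] Lv by simp_all
  have oldD: "old n \<beta> \<subseteq> dirs n" "old n (insert i \<beta>) = insert i (old n \<beta>)" "i \<in> dirs n - old n \<beta>"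
      "i \<noteq> ?a" "i \<noteq> ?b"
    if "\<beta> \<subseteq> dirs (Suc n)" "i \<in> dirs n" "i \<notin> \<beta>" for \<beta> i
    using that dirs_Suc new by auto
  have oldS: "old n \<beta> \<subseteq> dirs n" if "\<beta> \<subseteq> dirs (Suc n)" for \<beta>
    using that dirs_Suc by auto
  have old_new: "old n (insert ?a \<beta>) = old n \<beta>" "old n (insert ?b \<beta>) = old n \<beta>" for \<beta>
    by auto
  note simps = edge_Gfib_Suc vertex_Gfib_Suc Let_def plain_cat_simps(1,2) primed_cat_simps(1,2)
    insert_iff old_new
  have E: "small_category (edge ?D \<beta> i) \<and> Obj (edge ?D \<beta> i) = vertex ?D \<beta> \<and>
      Mor (edge ?D \<beta> i) = vertex ?D (insert i \<beta>)"
    if b: "\<beta> \<subseteq> dirs (Suc n)" and i: "i \<in> dirs (Suc n)" "i \<notin> \<beta>" for \<beta> i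
  proof -
    consider "i = ?a" | "i = ?b" | "i \<in> dirs n"
      using i unfolding dirs_Suc by blast
    then show ?thesis
    proof cases
      case 3
      note o = oldD[OF b 3 i(2)]
      show ?thesis
        using o small_category_dcat[OF IHe(1)[OF o(1,3)] Le[OF o(1,3)]] IHe(2,3)[OF o(1,3)]
        by (simp add: simps)
    qed (use i in \<open>simp_all add: simps small_category_plain_cat[OF Lv] small_category_primed_cat[OF Lv]\<close>)
  qed
  have F1: "double_category (edge ?D \<beta> i) (edge ?D (insert ?a \<beta>) i) (edge ?D \<beta> ?a) (edge ?D (insert i \<beta>) ?a)"
    if b: "\<beta> \<subseteq> dirs (Suc n)" and i: "i \<in> dirs n" "i \<notin> \<beta>" and a: "?a \<notin> \<beta>" for \<beta> i
  proof -
    note o = oldD[OF b i]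
    show ?thesis
      using o a IHe(2,3)[OF o(1,3)]
        double_category_natural[OF natural_category_plain_cat IHe(1)[OF o(1,3)] Le[OF o(1,3)]]
      by (simp add: simps)
  qed
  have F2: "double_category (edge ?D \<beta> i) (edge ?D (insert ?b \<beta>) i) (edge ?D \<beta> ?b) (edge ?D (insert i \<beta>) ?b)"
    if b: "\<beta> \<subseteq> dirs (Suc n)" and i: "i \<in> dirs n" "i \<notin> \<beta>" and a: "?b \<notin> \<beta>" for \<beta> i
  proof -
    note o = oldD[OF b i]
    show ?thesis
      using o a IHe(2,3)[OF o(1,3)]
        double_category_natural[OF natural_category_primed_cat IHe(1)[OF o(1,3)] Le[OF o(1,3)]]
      by (simp add: simps)
  qed
  have F3: "double_category (edge ?D \<beta> ?a) (edge ?D (insert ?b \<beta>) ?a) (edge ?D \<beta> ?b) (edge ?D (insert ?a \<beta>) ?b)"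
    if "?a \<notin> \<beta>" "?b \<notin> \<beta>" for \<beta>
    using that double_category_first_order[OF Lv] by (simp add: simps)
  have F4: "double_category (edge ?D \<beta> i) (edge ?D (insert j \<beta>) i) (edge ?D \<beta> j) (edge ?D (insert i \<beta>) j)"
    if b: "\<beta> \<subseteq> dirs (Suc n)" and i: "i \<in> dirs n" "i \<notin> \<beta>" and j: "j \<in> dirs n" "j \<notin> \<beta>" and ij: "i \<noteq> j" for \<beta> i j
  proof -
    note o = oldD[OF b i] and p = oldD[OF b j]
    have q: "insert j (old n \<beta>) \<subseteq> dirs n" "i \<in> dirs n - insert j (old n \<beta>)"
      using o p ij by auto
    show ?thesis
      using o p double_category_dcat[OF IHf[OF o(1,3) p(3) ij] Le[OF o(1,3)] Le[OF q]]
      by (simp add: simps insert_commute)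
  qed
  have F: "double_category (edge ?D \<beta> i) (edge ?D (insert j \<beta>) i) (edge ?D \<beta> j) (edge ?D (insert i \<beta>) j)"
    if b: "\<beta> \<subseteq> dirs (Suc n)" and i: "i \<in> dirs (Suc n)" "i \<notin> \<beta>" and j: "j \<in> dirs (Suc n)" "j \<notin> \<beta>" and ij: "i \<noteq> j" for \<beta> i j
  proof -
    \<comment> \<open>Faces are indexed by ordered pairs of directions; the orders not treated above
      follow from \<open>double_category_sym\<close>.\<close>
    consider "i \<in> dirs n" "j \<in> dirs n" | "i \<in> dirs n" "j = ?a" | "i \<in> dirs n" "j = ?b"
      | "i = ?a" "j \<in> dirs n" | "i = ?b" "j \<in> dirs n" | "i = ?a" "j = ?b" | "i = ?b" "j = ?a"
      using i(1) j(1) ij unfolding dirs_Suc by blast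
    then show ?thesis
    proof cases
      case 1 then show ?thesis using F4 b i j ij by blast
    next
      case 2 then show ?thesis using F1 b i j by blast
    next
      case 3 then show ?thesis using F2 b i j by blast
    next
      case 4 then show ?thesis using F1[of \<beta> j] b i j double_category_sym by blast
    next
      case 5 then show ?thesis using F2[of \<beta> j] b i j double_category_sym by blast
    next
      case 6 then show ?thesis using F3 i j by blast
    next
      case 7 then show ?thesis using F3 i j double_category_sym by blast
    qed
  qed
  show ?case
    unfolding mfold_category_def index_Gfib using E F by simp
qed

end

text \<open>The iterated difference quotients of f. Each level derives the vertex map of the
  preceding level at the same old directions, and f occurs in \<open>dmap\<close> only to convert
  the type of the scalars.\<close>

primrec tower :: "'k ring \<Rightarrow> ('k, 'v) module \<Rightarrow> ('k, 'w) module \<Rightarrow> ('v \<Rightarrow> 'w) \<Rightarrow> nat \<Rightarrow> dir set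
    \<Rightarrow> ('v, 'k) tup \<Rightarrow> ('w, 'k) tup" where
  "tower K V V' f 0 = (\<lambda>\<alpha> x. Vec (f (unVec x)))"
| "tower K V V' f (Suc n) = (\<lambda>\<alpha>.
     dmap f K (Plain (Suc n) \<in> \<alpha>) (Primed (Suc n) \<in> \<alpha>) (ambientb K V n (old n \<alpha>)) (ambientb K V' n (old n \<alpha>))
       (tower K V V' f n (old n \<alpha>)))"

context unital_scalars
begin

lemma tower_in:
  assumes L: "linear_set K U V" and L': "linear_set K U' V'" and f: "f \<in> U \<rightarrow> U'"
  shows "tower K V V' f n \<alpha> \<in> vertex (Gfib K U V n) \<alpha> \<rightarrow> vertex (Gfib K U' V' n) \<alpha>"
proof (induction n arbitrary: \<alpha>)
  case 0
  show ?case using f by auto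
next
  case (Suc n)
  show ?case unfolding vertex_Gfib_Suc tower.simps
    by (intro funcsetI dmap_in[OF linear_set_vertex[OF L] linear_set_vertex[OF L'] Suc])
qed

text \<open>In the new directions any map between the vertex sets would do; the induction hypothesis
  enters only in the old ones, where a functor of level n is derived.\<close>

lemma is_functor_tower:
  assumes L: "linear_set K U V" and L': "linear_set K U' V'" and f: "f \<in> U \<rightarrow> U'"
    and "\<beta> \<subseteq> dirs n" "i \<in> dirs n - \<beta>"
  shows "is_functor (edge (Gfib K U V n) \<beta> i) (edge (Gfib K U' V' n) \<beta> i)
    (tower K V V' f n \<beta>) (tower K V V' f n (insert i \<beta>))"
  using assms(4,5)
proof (induction n arbitrary: \<beta> i)
  case (Suc n)
  note Lv = linear_set_vertex[OF L, of n] and Lv' = linear_set_vertex[OF L', of n] and h = tower_in[OF L L' f, of n]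
  let ?a = "Plain (Suc n)" and ?b = "Primed (Suc n)"
  have dirs_Suc: "dirs (Suc n) = dirs n \<union> {?a, ?b}"
    by (auto simp: atLeastAtMostSuc_conv)
  consider "i = ?a" | "i = ?b" | "i \<in> dirs n"
    using Suc.prems unfolding dirs_Suc by blast
  then show ?case
  proof cases
    case 1
    moreover have "old n (insert ?a \<beta>) = old n \<beta>" by auto
    ultimately show ?thesis
      using Suc.prems is_functor_plain_cat[OF Lv Lv' h] by (simp add: edge_Gfib_Suc Let_def)
  next
    case 2
    moreover have "old n (insert ?b \<beta>) = old n \<beta>" by auto
    ultimately show ?thesis
      using Suc.prems is_functor_primed_cat[OF Lv Lv' h] by (simp add: edge_Gfib_Suc Let_def)
  next
    case 3
    have o: "old n \<beta> \<subseteq> dirs n" "old n (insert i \<beta>) = insert i (old n \<beta>)" "i \<in> dirs n - old n \<beta>"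
      "i \<noteq> ?a" "i \<noteq> ?b"
      using Suc.prems 3 dirs_Suc by auto
    have E: "small_category (edge (Gfib K U V n) (old n \<beta>) i)"
      "Obj (edge (Gfib K U V n) (old n \<beta>) i) = vertex (Gfib K U V n) (old n \<beta>)"
      "Mor (edge (Gfib K U V n) (old n \<beta>) i) = vertex (Gfib K U V n) (insert i (old n \<beta>))"
      using mfold_category_edge[OF mfold_category_Gfib[OF L], unfolded index_Gfib, OF o(1,3)] .
    have E': "Obj (edge (Gfib K U' V' n) (old n \<beta>) i) = vertex (Gfib K U' V' n) (old n \<beta>)"
      "Mor (edge (Gfib K U' V' n) (old n \<beta>) i) = vertex (Gfib K U' V' n) (insert i (old n \<beta>))"
      using mfold_category_edge(2,3)[OF mfold_category_Gfib[OF L'], unfolded index_Gfib, OF o(1,3)] .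
    show ?thesis
      using o is_functor_dcat[OF Suc.IH[OF o(1,3)] small_category_well_typed[OF E(1)], unfolded E(2,3) E', OF Lv Lv Lv' Lv']
      by (simp add: edge_Gfib_Suc Let_def)
  qed
qed simp

lemma tower_unique_b:
  assumes L: "linear_set K U V" and L': "linear_set K U' V'" and f: "f \<in> U \<rightarrow> U'"
    and M: "\<And>n. mfold_category_morphism (Gfib K U V n) (Gfib K U' V' n) (F n)"
    and comp: "compatibleb K U V F" and F0: "\<And>x. x \<in> U \<Longrightarrow> F 0 {} (Vec x) = Vec (f x)"
    and "\<alpha> \<subseteq> dirs n" "x \<in> vertex (Gfib K U V n) \<alpha>"
  shows "F n \<alpha> x = tower K V V' f n \<alpha> x"
  using assms(7,8)
proof (induction n arbitrary: \<alpha> x)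
  case 0
  then show ?case using F0 by auto
next
  case (Suc n)
  let ?a = "Plain (Suc n)" and ?b = "Primed (Suc n)" and ?g = "old n \<alpha>"
  let ?D = "Gfib K U V (Suc n)" and ?D' = "Gfib K U' V' (Suc n)" and ?t = "tower K V V' f (Suc n)"
  have dirs_Suc: "dirs (Suc n) = dirs n \<union> {?a, ?b}"
    by (auto simp: atLeastAtMostSuc_conv)
  have g: "?g \<subseteq> dirs n" using Suc.prems dirs_Suc by auto
  have old_g: "old n ?g = ?g" "old n (insert ?a ?g) = ?g" "old n (insert ?b ?g) = ?g"
    "old n (insert ?a (insert ?b ?g)) = ?g" by auto
  note Lv = linear_set_vertex[OF L, of n ?g] and Lv' = linear_set_vertex[OF L', of n ?g]
    and h = tower_in[OF L L' f, of n ?g]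
  have Fun: "is_functor (edge ?D \<beta> i) (edge ?D' \<beta> i) (F (Suc n) \<beta>) (F (Suc n) (insert i \<beta>))"
    if "\<beta> \<subseteq> dirs (Suc n)" "i \<in> dirs (Suc n) - \<beta>" for \<beta> i
    using mfold_category_morphism_functor[OF M, unfolded index_Gfib, OF that] .
  \<comment> \<open>Compatibility is used here, and it determines the morphism only at the vertex
    free of both new directions.\<close>
  have base: "F (Suc n) ?g p = ?t ?g p" if p: "p \<in> vertex ?D ?g" for p
  proof -
    obtain x t where "p = (x \<^bold>, Scal t)" "x \<in> vertex (Gfib K U V n) ?g" "t \<in> Units K"
      using p by (auto simp: vertex_Gfib_Suc old_g dset_False scalars_False_iff)
    then show ?thesis
      using comp g Suc.IH[OF g] by (simp add: compatibleb_def index_Gfib)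
  qed
  have Fa: "F (Suc n) (insert ?a ?g) p = ?t (insert ?a ?g) p" if "p \<in> vertex ?D (insert ?a ?g)" for p
    using plain_functor_unique[OF Lv Lv' h, of False "F (Suc n) ?g" "F (Suc n) (insert ?a ?g)" f p]
      Fun[of ?g ?a] base that g dirs_Suc by (auto simp: vertex_Gfib_Suc old_g edge_Gfib_Suc Let_def)
  have Fb: "F (Suc n) (insert ?b ?g) p = ?t (insert ?b ?g) p" if "p \<in> vertex ?D (insert ?b ?g)" for p
    using primed_functor_unique[OF Lv Lv' h, of "F (Suc n) ?g" "F (Suc n) (insert ?b ?g)" f p]
      Fun[of ?g ?b] base that g dirs_Suc by (auto simp: vertex_Gfib_Suc old_g edge_Gfib_Suc Let_def)
  \<comment> \<open>The edge in direction k starting at {k'}: its object part is known from the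
    preceding step, with scalars (s, t).\<close>
  have Fab: "F (Suc n) (insert ?a (insert ?b ?g)) p = ?t (insert ?a (insert ?b ?g)) p"
    if "p \<in> vertex ?D (insert ?a (insert ?b ?g))" for p
    using plain_functor_unique[OF Lv Lv' h, of True "F (Suc n) (insert ?b ?g)" "F (Suc n) (insert ?a (insert ?b ?g))" f p]
      Fun[of "insert ?b ?g" ?a] Fb that g dirs_Suc by (auto simp: vertex_Gfib_Suc old_g edge_Gfib_Suc Let_def)
  consider "\<alpha> = ?g" | "\<alpha> = insert ?a ?g" | "\<alpha> = insert ?b ?g" | "\<alpha> = insert ?a (insert ?b ?g)"
    by blast
  then show ?case
    by cases (use Suc.prems(2) base Fa Fb Fab in metis)+
qed

text \<open>Here F is given at unprimed vertices only and is not assumed to extend to the 2n-fold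
  categories, so the induction is carried out anew with a single new direction.\<close>

lemma tower_unique:
  assumes L: "linear_set K U V" and L': "linear_set K U' V'" and f: "f \<in> U \<rightarrow> U'"
    and M: "\<And>n. mfold_category_morphism (Gfi K U V n) (Gfi K U' V' n) (F n)"
    and comp: "compatible K U V F" and F0: "\<And>x. x \<in> U \<Longrightarrow> F 0 {} (Vec x) = Vec (f x)"
    and "\<alpha> \<subseteq> {1..n}" "x \<in> vertex (Gfi K U V n) \<alpha>"
  shows "F n \<alpha> x = tower K V V' f n (Plain ` \<alpha>) x"
  using assms(7,8)
proof (induction n arbitrary: \<alpha> x)
  case 0
  then show ?case using F0 by auto
next
  case (Suc n)
  let ?g = "\<alpha> - {Suc n}"
  let ?D = "Gfi K U V (Suc n)" and ?D' = "Gfi K U' V' (Suc n)" and ?t = "\<lambda>\<alpha>. tower K V V' f (Suc n) (Plain ` \<alpha>)"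
  have g: "?g \<subseteq> {1..n}" using Suc.prems by (auto simp: atLeastAtMostSuc_conv)
  have old_g: "old n (Plain ` ?g) = Plain ` ?g" "old n (insert (Plain (Suc n)) (Plain ` ?g)) = Plain ` ?g" by auto
  note Lv = linear_set_vertex[OF L, of n "Plain ` ?g"] and Lv' = linear_set_vertex[OF L', of n "Plain ` ?g"]
    and h = tower_in[OF L L' f, of n "Plain ` ?g"]
  have base: "F (Suc n) ?g p = ?t ?g p" if p: "p \<in> vertex ?D ?g" for p
  proof -
    obtain x t where "p = (x \<^bold>, Scal t)" "x \<in> vertex (Gfi K U V n) ?g" "t \<in> Units K"
      using p by (auto simp: vertex_Gfi_eq vertex_Gfib_Suc old_g dset_False scalars_False_iff)
    then show ?thesis
      using comp g Suc.IH[OF g] by (simp add: compatible_def index_Gfi image_Plain_old)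
  qed
  have Fun: "is_functor (edge ?D ?g (Suc n)) (edge ?D' ?g (Suc n)) (F (Suc n) ?g) (F (Suc n) (insert (Suc n) ?g))"
    by (rule mfold_category_morphism_functor[OF M]) (use g in \<open>auto simp: index_Gfi\<close>)
  have Fa: "F (Suc n) (insert (Suc n) ?g) p = ?t (insert (Suc n) ?g) p" if "p \<in> vertex ?D (insert (Suc n) ?g)" for p
    using plain_functor_unique[OF Lv Lv' h, of False "F (Suc n) ?g" "F (Suc n) (insert (Suc n) ?g)" f p]
      Fun base that by (auto simp: vertex_Gfi_eq vertex_Gfib_Suc old_g image_Plain_old edge_Gfi_eq edge_Gfib_Suc Let_def)
  show ?case
  proof (cases "Suc n \<in> \<alpha>")
    case True
    then show ?thesis using Fa Suc.prems(2) by (simp only: insert_Diff)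
  next
    case False
    then have eq: "?g = \<alpha>" by simp
    show ?thesis using base[unfolded eq, OF Suc.prems(2)] .
  qed
qed

text \<open>Edges and faces are those of the 2n-fold category at plain directions. Inverses follow
  by induction, from \<open>small_groupoid_plain_cat\<close> in the new direction and
  \<open>small_groupoid_dcat\<close> in the old ones.\<close>

lemma mfold_groupoid_Gfi:
  assumes L: "linear_set K U V"
  shows "mfold_groupoid (Gfi K U V n)"
proof -
  have Pl: "Plain ` \<beta> \<subseteq> dirs n" "Plain i \<in> dirs n - Plain ` \<beta>" if "\<beta> \<subseteq> {1..n}" "i \<in> {1..n} - \<beta>" for \<beta> i n
    using that by auto
  have E: "small_category (edge (Gfib K U V n) \<gamma> i)" "Obj (edge (Gfib K U V n) \<gamma> i) = vertex (Gfib K U V n) \<gamma>"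
    "Mor (edge (Gfib K U V n) \<gamma> i) = vertex (Gfib K U V n) (insert i \<gamma>)" if "\<gamma> \<subseteq> dirs n" "i \<in> dirs n - \<gamma>" for \<gamma> i n
    using mfold_category_edge[OF mfold_category_Gfib[OF L], unfolded index_Gfib, OF that] .
  have F: "double_category (edge (Gfib K U V n) \<gamma> i) (edge (Gfib K U V n) (insert j \<gamma>) i)
      (edge (Gfib K U V n) \<gamma> j) (edge (Gfib K U V n) (insert i \<gamma>) j)"
    if "\<gamma> \<subseteq> dirs n" "i \<in> dirs n - \<gamma>" "j \<in> dirs n - \<gamma>" "i \<noteq> j" for \<gamma> i j
    using mfold_category_face[OF mfold_category_Gfib[OF L], unfolded index_Gfib, OF that] .
  have "mfold_category (Gfi K U V n)"
    unfolding mfold_category_def index_Gfi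
  proof (intro conjI allI impI)
    fix \<beta> i assume b: "\<beta> \<subseteq> {1..n}" "i \<in> {1..n} - \<beta>"
    then show "small_category (edge (Gfi K U V n) \<beta> i)" "Obj (edge (Gfi K U V n) \<beta> i) = vertex (Gfi K U V n) \<beta>"
      "Mor (edge (Gfi K U V n) \<beta> i) = vertex (Gfi K U V n) (insert i \<beta>)"
      using E[OF Pl[OF b]] by (simp_all add: edge_Gfi_eq vertex_Gfi_eq)
    fix j assume j: "j \<in> {1..n} - \<beta>" "i \<noteq> j"
    show "double_category (edge (Gfi K U V n) \<beta> i) (edge (Gfi K U V n) (insert j \<beta>) i)
      (edge (Gfi K U V n) \<beta> j) (edge (Gfi K U V n) (insert i \<beta>) j)"
      using F[OF Pl[OF b] Pl(2)[OF b(1) j(1)]] b j by (simp add: edge_Gfi_eq)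
  qed simp
  moreover have "small_groupoid (edge (Gfib K U V n) (Plain ` \<beta>) (Plain i))"
    if "\<beta> \<subseteq> {1..n}" "i \<in> {1..n} - \<beta>" for \<beta> i
    using that
  proof (induction n arbitrary: \<beta> i)
    case (Suc n)
    show ?case
    proof (cases "i = Suc n")
      case True
      have "Primed (Suc n) \<notin> Plain ` \<beta>" by auto
      with True show ?thesis
        by (simp add: edge_Gfib_Suc Let_def small_groupoid_plain_cat[OF linear_set_vertex[OF L]])
    next
      case False
      then have b: "\<beta> - {Suc n} \<subseteq> {1..n}" "i \<in> {1..n} - (\<beta> - {Suc n})"
        using Suc.prems by (auto simp: atLeastAtMostSuc_conv)
      have "linear_set K (Obj (edge (Gfib K U V n) (Plain ` (\<beta> - {Suc n})) (Plain i))) (ambientb K V n (Plain ` (\<beta> - {Suc n})))"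
        "linear_set K (Mor (edge (Gfib K U V n) (Plain ` (\<beta> - {Suc n})) (Plain i)))
          (ambientb K V n (insert (Plain i) (Plain ` (\<beta> - {Suc n}))))"
        unfolding E(2,3)[OF Pl[OF b]] by (rule linear_set_vertex[OF L])+
      from small_groupoid_dcat[OF Suc.IH[OF b] this] False show ?thesis
        by (simp add: edge_Gfib_Suc Let_def image_Plain_old)
    qed
  qed simp
  ultimately show ?thesis
    unfolding mfold_groupoid_def index_Gfi by (auto simp: edge_Gfi_eq)
qed

text \<open>Compatibility of the tower is built in: at a vertex without new directions both flags
  are \<open>False\<close>, and deriving is then taking the product with the identity.\<close>

lemma tower_extend:
  assumes "Plain (Suc n) \<notin> \<alpha>" "Primed (Suc n) \<notin> \<alpha>"
  shows "tower K V V' f (Suc n) \<alpha> (x \<^bold>, Scal t) = (tower K V V' f n \<alpha> x \<^bold>, Scal t)"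
  using assms by (simp add: Diff_insert0)

lemma ex1_groupoid_tower:
  assumes L: "linear_set K U V" and L': "linear_set K U' V'" and f: "f \<in> U \<rightarrow> U'"
  shows "\<exists>!F. (\<forall>n. mfold_groupoid_morphism (Gfi K U V n) (Gfi K U' V' n) (F n)) \<and>
           compatible K U V F \<and> (\<forall>x\<in>U. F 0 {} (Vec x) = Vec (f x))"
proof -
  let ?C = "Gfi K U V" and ?D = "Gfi K U' V'"
  define F where "F n = (\<lambda>\<alpha>\<in>Pow (index (?C n)). restrict (tower K V V' f n (Plain ` \<alpha>)) (vertex (?C n) \<alpha>))" for n
  have mor: "mfold_category_morphism (?C n) (?D n) (F n)" for n
    unfolding F_def
  proof (rule mfold_category_morphism_restrictI)
    show "mfold_category (?C n)" "mfold_category (?D n)"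
      using mfold_groupoid_Gfi[OF L] mfold_groupoid_Gfi[OF L'] by (auto simp: mfold_groupoid_def)
    show "tower K V V' f n (Plain ` \<alpha>) \<in> vertex (?C n) \<alpha> \<rightarrow> vertex (?D n) \<alpha>" for \<alpha>
      unfolding vertex_Gfi_eq by (rule tower_in[OF L L' f])
    fix \<beta> i assume b: "\<beta> \<subseteq> index (?C n)" "i \<in> index (?C n) - \<beta>"
    then have "Plain ` \<beta> \<subseteq> dirs n" "Plain i \<in> dirs n - Plain ` \<beta>"
      by (auto simp: index_Gfi)
    from is_functor_tower[OF L L' f this] b
    show "is_functor (edge (?C n) \<beta> i) (edge (?D n) \<beta> i) (tower K V V' f n (Plain ` \<beta>))
        (tower K V V' f n (Plain ` insert i \<beta>))"
      by (simp add: edge_Gfi_eq index_Gfi)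
  qed (simp add: index_Gfi)
  show ?thesis
  proof (rule ex1I)
    show "(\<forall>n. mfold_groupoid_morphism (?C n) (?D n) (F n)) \<and> compatible K U V F \<and> (\<forall>x\<in>U. F 0 {} (Vec x) = Vec (f x))"
    proof (intro conjI allI)
      show "mfold_groupoid_morphism (?C n) (?D n) (F n)" for n
        using mor mfold_groupoid_Gfi[OF L] mfold_groupoid_Gfi[OF L']
        by (simp add: mfold_groupoid_morphism_def)
      show "compatible K U V F"
        unfolding compatible_def
      proof (intro allI impI ballI)
        fix n \<alpha> x t assume a: "\<alpha> \<subseteq> index (?C n)" "x \<in> vertex (?C n) \<alpha>" "t \<in> Units K"
        \<comment> \<open>Both sides are restrictions, so the vertex and the point must be seen to
          lie in the domains of level n+1 before the values can be compared.\<close>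
        then have *: "Suc n \<notin> \<alpha>" "\<alpha> \<subseteq> index (?C (Suc n))" by (auto simp: index_Gfi)
        then have "(x \<^bold>, Scal t) \<in> vertex (?C (Suc n)) \<alpha>"
          using a by (auto simp: Gfi.simps(2) pts_def)
        with a * show "F (Suc n) \<alpha> (x \<^bold>, Scal t) = (F n \<alpha> x \<^bold>, Scal t)"
          using tower_extend[of n "Plain ` \<alpha>"]
          by (auto simp: F_def simp del: tower.simps)
      qed
    qed (auto simp: F_def)
  next
    fix G assume "(\<forall>n. mfold_groupoid_morphism (?C n) (?D n) (G n)) \<and> compatible K U V G \<and> (\<forall>x\<in>U. G 0 {} (Vec x) = Vec (f x))"
    then have G: "\<And>n. mfold_category_morphism (?C n) (?D n) (G n)" "compatible K U V G"
      "\<And>x. x \<in> U \<Longrightarrow> G 0 {} (Vec x) = Vec (f x)"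
      by (auto simp: mfold_groupoid_morphism_def)
    show "G = F"
    proof
      show "G n = F n" for n
        by (rule mfold_category_morphism_eqI[OF G(1) mor])
          (simp add: tower_unique[OF L L' f G] F_def index_Gfi)
    qed
  qed
qed

lemma ex1_category_tower:
  assumes L: "linear_set K U V" and L': "linear_set K U' V'" and f: "f \<in> U \<rightarrow> U'"
  shows "\<exists>!F. (\<forall>n. mfold_category_morphism (Gfib K U V n) (Gfib K U' V' n) (F n)) \<and>
           compatibleb K U V F \<and> (\<forall>x\<in>U. F 0 {} (Vec x) = Vec (f x))"
proof -
  let ?C = "Gfib K U V" and ?D = "Gfib K U' V'"
  define F where "F n = (\<lambda>\<alpha>\<in>Pow (index (?C n)). restrict (tower K V V' f n \<alpha>) (vertex (?C n) \<alpha>))" for n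
  have mor: "mfold_category_morphism (?C n) (?D n) (F n)" for n
    unfolding F_def
    by (rule mfold_category_morphism_restrictI)
      (auto simp only: mfold_category_Gfib L L' f index_Gfib tower_in is_functor_tower)
  show ?thesis
  proof (rule ex1I)
    show "(\<forall>n. mfold_category_morphism (?C n) (?D n) (F n)) \<and> compatibleb K U V F \<and> (\<forall>x\<in>U. F 0 {} (Vec x) = Vec (f x))"
    proof (intro conjI allI)
      show "compatibleb K U V F"
        unfolding compatibleb_def
      proof (intro allI impI ballI)
        fix n \<alpha> x t assume a: "\<alpha> \<subseteq> index (?C n)" "x \<in> vertex (?C n) \<alpha>" "t \<in> Units K"
        then have *: "Plain (Suc n) \<notin> \<alpha>" "Primed (Suc n) \<notin> \<alpha>" "\<alpha> \<subseteq> index (?C (Suc n))"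
          by (auto simp: index_Gfib)
        then have "(x \<^bold>, Scal t) \<in> vertex (?C (Suc n)) \<alpha>"
          using a by (auto simp: Gfib.simps(2) pts_def)
        with a * show "F (Suc n) \<alpha> (x \<^bold>, Scal t) = (F n \<alpha> x \<^bold>, Scal t)"
          using tower_extend[of n \<alpha>]
          by (auto simp: F_def simp del: tower.simps)
      qed
    qed (use mor in \<open>auto simp: F_def\<close>)
  next
    fix G assume "(\<forall>n. mfold_category_morphism (?C n) (?D n) (G n)) \<and> compatibleb K U V G \<and> (\<forall>x\<in>U. G 0 {} (Vec x) = Vec (f x))"
    then have G: "\<And>n. mfold_category_morphism (?C n) (?D n) (G n)" "compatibleb K U V G"
      "\<And>x. x \<in> U \<Longrightarrow> G 0 {} (Vec x) = Vec (f x)"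
      by auto
    show "G = F"
    proof
      show "G n = F n" for n
        by (rule mfold_category_morphism_eqI[OF G(1) mor])
          (simp add: tower_unique_b[OF L L' f G] F_def index_Gfib)
    qed
  qed
qed

end

theorem theorem3p15:
  fixes K :: "'k ring" and V :: "('k, 'v) module" and V' :: "('k, 'w) module"
    and U :: "'v set" and U' :: "'w set" and f :: "'v \<Rightarrow> 'w"
  assumes "cring K" and "linear_set K U V" and "linear_set K U' V'" and "f \<in> U \<rightarrow> U'"
  shows "(\<exists>!F. (\<forall>n. mfold_groupoid_morphism (Gfi K U V n) (Gfi K U' V' n) (F n)) \<and>
               compatible K U V F \<and> (\<forall>x\<in>U. F 0 {} (Vec x) = Vec (f x)))
       \<and> (\<exists>!F. (\<forall>n. mfold_category_morphism (Gfib K U V n) (Gfib K U' V' n) (F n)) \<and>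
               compatibleb K U V F \<and> (\<forall>x\<in>U. F 0 {} (Vec x) = Vec (f x)))"
proof -
  interpret unital_scalars K
    using assms(1) by (simp add: unital_scalars_def)
  show ?thesis
    using ex1_groupoid_tower[OF assms(2-4)] ex1_category_tower[OF assms(2-4)] by blast
qed

end
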